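(* Let $G(s):=\sum_{\gamma>0}\gamma^{-s}$ for $\operatorname{Re}s>1$, where $\gamma$ runs over the ordinates of the nontrivial zeros of $\zeta(s)$, counted with multiplicity. Let $F(x):=S(x)+f(x)$ for $x\ge1$, with $S$ and $f$ as defined in the context, and let $C_1$ be the (unique) constant such that \[ G(s)=\frac{1}{2\pi(s-1)^2}-\frac{\log(2\pi)}{2\pi(s-1)}+C_1+s\int_1^\infty F(x)x^{-s-1}\,dx \qquad (\operatorname{Re}s>1). \] For $j=0,1,2,\ldots$ put \[ c_j:=\frac{(-1)^j}{j!}\int_1^\infty F(x)(\log x)^j x^{-2}\,dx . \] Then the Laurent expansion of (the meromorphic continuation of) $G(s)$ at $s=1$ has the form \[ G(s)=\frac{1}{2\pi(s-1)^2}-\frac{\log 2\pi}{2\pi(s-1)}+\sum_{j=0}^\infty b_j(s-1)^j, \] where $b_0=C_1+c_0$ and $b_j=c_j+c_{j-1}$ for $j=1,2,\ldots$.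
   Context: $N(T)$ denotes the number of zeros $\rho=\beta+i\gamma$ of $\zeta$ with $0<\gamma\le T$, counted with multiplicity. For $T$ not the ordinate of a zero, $S(T):=\frac1\pi\arg\zeta(\tfrac12+iT)$, where the argument is obtained by continuous variation along the straight segments from $2$ to $2+iT$ to $\tfrac12+iT$, starting with value $0$ at $s=2$; if $T$ is an ordinate of a zero, $S(T):=S(T+0)$. One has $S(T)\ll\log T$. The function $f$ is the smooth function defined by \[ N(T)=\frac{T}{2\pi}\log\frac{T}{2\pi}-\frac{T}{2\pi}+\frac78+S(T)+f(T), \] i.e. $f(T)=\frac{\theta(T)}{\pi}+\frac18-\frac{T}{2\pi}\log\frac{T}{2\pi}+\frac{T}{2\pi}$ with $\theta(T)=\operatorname{Im}\log\Gamma(\tfrac14+\tfrac{iT}{2})-\tfrac{T}{2}\log\pi$; it satisfies $f(T)=\sum_{j=1}^N a_jT^{1-2j}+O_N(T^{-2N-1})$ for explicit constants $a_j$. *)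

theory Defs
  imports "HOL-Complex_Analysis.Complex_Analysis"
begin

text \<open>The Riemann zeta function. The two conditions determine the function on all of
  \<open>- {1}\<close>; the value at the pole is left unspecified and is never used.\<close>

definition zeta :: "complex \<Rightarrow> complex" where
  "zeta = (SOME h. h holomorphic_on (- {1}) \<and>
             (\<forall>s. Re s > 1 \<longrightarrow> (\<lambda>n. 1 / of_nat (Suc n) powr s) sums h s))"

definition nontrivial_zeros :: "complex set" where
  "nontrivial_zeros = {\<rho>. zeta \<rho> = 0 \<and> 0 < Re \<rho> \<and> Re \<rho> < 1}"

definition is_ordinate :: "real \<Rightarrow> bool" where
  "is_ordinate T \<longleftrightarrow> (\<exists>\<rho>. zeta \<rho> = 0 \<and> Im \<rho> = T)"

text \<open>The sum over ordinates with multiplicity is a sum over distinct zeros, each weighted by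
  its order.\<close>

definition G :: "complex \<Rightarrow> complex" where
  "G s = (\<Sum>\<^sub>\<infinity>\<rho>\<in>{\<rho> \<in> nontrivial_zeros. Im \<rho> > 0}.
            of_int (zorder zeta \<rho>) * of_real (Im \<rho>) powr (- s))"

text \<open>The value at the end of the path of the continuous branch of the argument of \<open>g\<close>
  that starts with the value 0. It is meaningful if \<open>g\<close> is continuous and nonzero on the path
  and positive at its start.\<close>

definition arg_along :: "(complex \<Rightarrow> complex) \<Rightarrow> (real \<Rightarrow> complex) \<Rightarrow> real" where
  "arg_along g p = (THE a. \<exists>\<phi>. continuous_on {0..1} \<phi> \<and> \<phi> 0 = 0 \<and> \<phi> 1 = a \<and>
     (\<forall>t\<in>{0..1}. g (p t) = of_real (cmod (g (p t))) * cis (\<phi> t)))"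

definition S_regular :: "real \<Rightarrow> real" where
  "S_regular T = 1 / pi * arg_along zeta
     (linepath 2 (Complex 2 T) +++ linepath (Complex 2 T) (Complex (1/2) T))"

definition S :: "real \<Rightarrow> real" where
  "S T = (if is_ordinate T then Lim (at_right T) S_regular else S_regular T)"

text \<open>\<^const>\<open>ln_Gamma\<close> is the branch of the logarithm of Gamma that is holomorphic off the
  nonpositive real axis and real on the positive real axis.\<close>

definition theta :: "real \<Rightarrow> real" where
  "theta T = Im (ln_Gamma (Complex (1/4) (T/2))) - T / 2 * ln pi"

definition f :: "real \<Rightarrow> real" where
  "f T = theta T / pi + 1/8 - T / (2 * pi) * ln (T / (2 * pi)) + T / (2 * pi)"

definition F :: "real \<Rightarrow> real" where
  "F x = S x + f x"

definition c :: "nat \<Rightarrow> real" where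
  "c j = (-1) ^ j / fact j * (LINT x:{1..}|lborel. F x * ln x ^ j / x ^ 2)"

text \<open>A meromorphic continuation of \<^const>\<open>G\<close> from the half-plane \<open>Re s > 1\<close> to a domain
  \<open>U\<close> that also contains the boundary point 1.\<close>

definition is_continuation_of_G :: "complex set \<Rightarrow> (complex \<Rightarrow> complex) \<Rightarrow> bool" where
  "is_continuation_of_G U H \<longleftrightarrow>
     open U \<and> connected U \<and> {s. Re s > 1} \<subseteq> U \<and> 1 \<in> U \<and>
     H meromorphic_on U \<and> (\<forall>s. Re s > 1 \<longrightarrow> H s = G s)"

end

theory Submission
  imports Defs
begin

text \<open>Everything follows once \<^term>\<open>\<bar>F x\<bar> \<le> K * sqrt x\<close> is known for almost all \<^term>\<open>x \<ge> 1\<close>: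
  then the integral in the hypothesis converges absolutely for \<open>Re s > 1/2\<close>, and expanding
  \<open>x powr (1 - s) = exp ((1 - s) * ln x)\<close> under the integral gives its Taylor series
  \<open>\<Sum>j. c j * (s - 1) ^ j\<close> at 1; multiplying by \<open>s = 1 + (s - 1)\<close> yields the coefficients
  \<open>c j + c (j - 1)\<close>. The bound on \<^const>\<open>S\<close> is Backlund's: the argument of zeta along the
  horizontal segment is controlled by the number of zeros of a real part, which Jensen's
  inequality bounds logarithmically in terms of the polynomial growth of zeta. The bound on
  \<^const>\<open>f\<close> compares the sum of arctangents defining the argument of Gamma with its integral.\<close>

subsection \<open>Analytic continuation and growth of zeta\<close>

text \<open>\<open>zeta\<close> is given by a choice operator, so nothing about it is usable until
  an analytic continuation has been constructed; the recursion used for that also yields the growth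
  estimate, through its instance \<open>K = 1\<close>. The argument in \<open>S\<close> is likewise
  a definite description, so existence and uniqueness of a continuous branch come before any
  estimate. The exponent 1/2 in \<open>sqrt x\<close> is a convenience: any exponent below 1 moves
  the line of convergence strictly to the left of 1, and \<open>sqrt x\<close> absorbs logarithmic
  and bounded terms alike for \<open>x \<ge> 1\<close>. A continuation in the theorem may live on
  any domain, so it is compared with the constructed one only near 1.\<close>

lemma holomorphic_on_suminf:
  fixes g :: "nat \<Rightarrow> complex \<Rightarrow> complex"
  assumes "open A" and hol: "\<And>n. g n holomorphic_on A"
    and bound: "\<And>x. x \<in> A \<Longrightarrow> \<exists>d>0. \<exists>M. cball x d \<subseteq> A \<and> summable M \<and>
                  (\<forall>n. \<forall>y\<in>cball x d. norm (g n y) \<le> M n)"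
  shows "(\<lambda>s. \<Sum>n. g n s) holomorphic_on A"
proof (rule holomorphic_uniform_sequence[OF \<open>open A\<close>])
  show "(\<lambda>s. \<Sum>k<n. g k s) holomorphic_on A" for n
    by (intro holomorphic_intros hol)
  fix x assume "x \<in> A"
  from bound[OF this] obtain d M where dM: "d > 0" "cball x d \<subseteq> A" "summable M"
     "\<forall>n. \<forall>y\<in>cball x d. norm (g n y) \<le> M n" by (elim exE conjE) (rule that)
  have "uniform_limit (cball x d) (\<lambda>n s. \<Sum>k<n. g k s) (\<lambda>s. \<Sum>n. g n s) sequentially"
    using dM(4) by (intro Weierstrass_m_test[of "cball x d" g M] dM(3)) simp
  with dM show "\<exists>d>0. cball x d \<subseteq> A \<and>
         uniform_limit (cball x d) (\<lambda>n s. \<Sum>k<n. g k s) (\<lambda>s. \<Sum>n. g n s) sequentially"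
    by (intro exI[of _ d]) simp
qed

text \<open>Error of the Taylor polynomial of degree \<open>K\<close> of
  \<open>z powr (1 - s)\<close> at \<open>n\<close>, evaluated at \<open>n + 1\<close>; the step has
  length 1, so its powers do not show.\<close>

definition taylor_rem :: "nat \<Rightarrow> nat \<Rightarrow> complex \<Rightarrow> complex" where
  "taylor_rem K n s = of_nat (Suc n) powr (1 - s)
     - (\<Sum>i\<le>K. ((1 - s) gchoose i) * of_nat n powr (1 - s - of_nat i))"

text \<open>On the segment the derivative of order \<open>K + 1\<close> has modulus proportional to
  \<open>r powr (- Re s - K)\<close>, which is largest at the left end because
  \<open>Re s + K \<ge> 0\<close>. The factor \<open>1 / K!\<close> in Taylor's estimate is bounded
  by 1.\<close>

lemma taylor_rem_bound:
  assumes n: "n \<ge> 1" and K: "Re s + real K \<ge> 0"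
  shows "norm (taylor_rem K n s) \<le>
           norm (fact (Suc K) * ((1 - s) gchoose Suc K)) * real n powr (- Re s - real K)"
proof -
  let ?S = "closed_segment (of_nat n) (of_nat (Suc n)) :: complex set"
  let ?f = "\<lambda>i z. fact i * ((1 - s) gchoose i) * z powr (1 - s - of_nat i)"
  let ?B = "norm (fact (Suc K) * ((1 - s) gchoose Suc K)) * real n powr (- Re s - real K)"
  have seg: "\<exists>r. x = of_real r \<and> real n \<le> r" if "x \<in> ?S" for x
  proof -
    have "x \<in> closed_segment (of_real (real n)) (of_real (real (Suc n)))"
      using that by simp
    then show ?thesis
      unfolding closed_segment_of_real by (auto simp: closed_segment_eq_real_ivl)
  qed
  have "norm (?f 0 (of_nat (Suc n)) - (\<Sum>i\<le>K. ?f i (of_nat n) * (of_nat (Suc n) - of_nat n) ^ i / fact i))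
        \<le> ?B * norm (of_nat (Suc n) - of_nat n :: complex) ^ Suc K / fact K"
  proof (rule complex_Taylor[where S = ?S])
    show "(?f i has_field_derivative ?f (Suc i) x) (at x within ?S)" if "x \<in> ?S" for i x
    proof -
      obtain r where r: "x = of_real r" "real n \<le> r" using seg \<open>x \<in> ?S\<close> by blast
      have "x \<notin> \<real>\<^sub>\<le>\<^sub>0" using r n by simp
      have g: "of_nat (Suc i) * ((1 - s) gchoose Suc i) = (1 - s - of_nat i) * ((1 - s) gchoose i)"
        using gbinomial_mult_1[of "1 - s" i] by (simp add: algebra_simps)
      have "(?f i has_field_derivative (fact i * ((1 - s) gchoose i)) *
               ((1 - s - of_nat i) * x powr (1 - s - of_nat i - 1))) (at x within ?S)"
        using \<open>x \<notin> \<real>\<^sub>\<le>\<^sub>0\<close>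
        by (intro DERIV_cmult has_field_derivative_powr has_field_derivative_at_within) auto
      also have "(fact i * ((1 - s) gchoose i)) * ((1 - s - of_nat i) * x powr (1 - s - of_nat i - 1))
         = fact i * (of_nat (Suc i) * ((1 - s) gchoose Suc i)) * x powr (1 - s - of_nat i - 1)"
        unfolding g by (simp add: mult_ac)
      also have "\<dots> = ?f (Suc i) x"
        by (simp add: algebra_simps)
      finally show ?thesis .
    qed
    show "norm (?f (Suc K) x) \<le> ?B" if "x \<in> ?S" for x
    proof -
      obtain r where r: "x = of_real r" "real n \<le> r" using seg \<open>x \<in> ?S\<close> by blast
      have "norm (x powr (1 - s - of_nat (Suc K))) = r powr (- Re s - real K)"
        using r n by (subst r(1), subst norm_powr_real_powr) (auto simp: algebra_simps)
      also have "\<dots> \<le> real n powr (- Re s - real K)"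
        using r n K by (intro powr_mono2') auto
      finally show ?thesis by (simp only: norm_mult mult_left_mono norm_ge_zero mult_nonneg_nonneg)
    qed
  qed auto
  also have "\<dots> \<le> ?B * 1 / 1"
    by (intro frac_le mult_mono) (auto simp: fact_ge_1)
  finally show ?thesis
    unfolding taylor_rem_def by (simp add: field_simps)
qed

lemma powr_holomorphic_exponent:
  assumes "n \<ge> 1" and "h holomorphic_on A"
  shows "(\<lambda>s. of_nat n powr h s) holomorphic_on A"
  using assms by (intro holomorphic_intros) auto

lemma holomorphic_on_taylor_rem:
  assumes "n \<ge> 1"
  shows "taylor_rem K n holomorphic_on A"
  unfolding taylor_rem_def gbinomial_prod_rev using assms
  by (intro holomorphic_intros powr_holomorphic_exponent) auto

lemma holomorphic_on_suminf_taylor_rem: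
  "(\<lambda>s. \<Sum>n. taylor_rem K (Suc n) s) holomorphic_on {s. Re s > 1 - real K}"
proof (rule holomorphic_on_suminf)
  show "open {s. Re s > 1 - real K}" by (simp add: open_halfspace_Re_gt)
  show "taylor_rem K (Suc n) holomorphic_on {s. Re s > 1 - real K}" for n
    by (rule holomorphic_on_taylor_rem) simp
  fix x assume x: "x \<in> {s. Re s > 1 - real K}"
  \<comment> \<open>Half the distance from \<open>x\<close> to the boundary line: on the disc the
    exponents are at most \<open>- 1 - d\<close>, which makes the majorant summable.\<close>
  define d where "d = (Re x + K - 1) / 2"
  have d: "d > 0" using x by (simp add: d_def)
  have Re: "Re y \<ge> 1 - real K + d" if "y \<in> cball x d" for y
  proof -
    have "\<bar>Re (x - y)\<bar> \<le> d" using that abs_Re_le_cmod[of "x - y"] by (simp add: dist_norm)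
    then have "Re x - Re y \<le> d" by simp
    then show ?thesis unfolding d_def by (simp add: field_simps)
  qed
  have "compact ((\<lambda>s. fact (Suc K) * ((1 - s) gchoose Suc K)) ` cball x d)"
    unfolding gbinomial_prod_rev
    by (intro compact_continuous_image continuous_intros) (auto simp del: of_nat_Suc)
  then have "bounded ((\<lambda>s. fact (Suc K) * ((1 - s) gchoose Suc K)) ` cball x d)"
    by (rule compact_imp_bounded)
  then obtain B where B: "\<And>s. s \<in> cball x d \<Longrightarrow> norm (fact (Suc K) * ((1 - s) gchoose Suc K)) \<le> B"
    unfolding bounded_iff by blast
  have "B \<ge> 0" using B[of x] d norm_ge_zero order_trans by (metis centre_in_cball less_imp_le)
  define M where "M = (\<lambda>n. B * real (Suc n) powr (- 1 - d))"
  have "summable M"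
    unfolding M_def using d 
    by (intro summable_mult) (subst summable_Suc_iff, simp add: summable_real_powr_iff)
  moreover have "cball x d \<subseteq> {s. Re s > 1 - real K}" using Re d by fastforce
  moreover have "norm (taylor_rem K (Suc n) y) \<le> M n" if "y \<in> cball x d" for n y
  proof -
    have "norm (taylor_rem K (Suc n) y) \<le> norm (fact (Suc K) * ((1 - y) gchoose Suc K)) 
            * real (Suc n) powr (- Re y - real K)"
      using Re[OF that] d by (intro taylor_rem_bound) auto
    also have "\<dots> \<le> M n" unfolding M_def
      using Re[OF that] B[OF that] \<open>B \<ge> 0\<close> by (intro mult_mono powr_mono) auto
    finally show ?thesis .
  qed
  ultimately show "\<exists>d>0. \<exists>M. cball x d \<subseteq> {s. Re s > 1 - real K} \<and> summable M \<and>
                  (\<forall>n. \<forall>y\<in>cball x d. norm (taylor_rem K (Suc n) y) \<le> M n)"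
    using d by blast
qed

text \<open>The series has its own name because \<open>zeta\<close> can be identified with it only
  after some continuation is known to exist.\<close>

definition dseries :: "complex \<Rightarrow> complex" where
  "dseries s = (\<Sum>n. 1 / of_nat (Suc n) powr s)"

lemma norm_dseries_term: "norm (1 / of_nat (Suc n) powr s) = real (Suc n) powr (- Re s)"
  by (simp add: norm_divide norm_powr_real_powr powr_minus_divide del: of_nat_Suc)

lemma dseries_sums:
  assumes "Re s > 1"
  shows "(\<lambda>n. 1 / of_nat (Suc n) powr s) sums dseries s"
proof -
  have "summable (\<lambda>n. real (Suc n) powr (- Re s))"
    using assms by (subst summable_Suc_iff) (simp add: summable_real_powr_iff)
  then have "summable (\<lambda>n. norm (1 / of_nat (Suc n) powr s))"
    unfolding norm_dseries_term .
  then show ?thesis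
    unfolding dseries_def by (rule summable_sums[OF summable_norm_cancel])
qed

lemma suminf_taylor_rem:
  assumes s: "Re s > 1"
  shows "(\<Sum>n. taylor_rem K (Suc n) s) = - 1 - (\<Sum>i=1..K. ((1 - s) gchoose i) * dseries (s + of_nat i - 1))"
proof -
  have "(\<lambda>n. of_nat (Suc n) powr (1 - s) :: complex) \<longlonglongrightarrow> 0"
  proof (rule tendsto_norm_zero_cancel)
    have "(\<lambda>n. real (Suc n) powr (- (Re s - 1))) \<longlonglongrightarrow> 0"
      using s by (intro tendsto_neg_powr filterlim_compose[OF filterlim_real_sequentially] filterlim_Suc) auto
    then show "(\<lambda>n. norm (of_nat (Suc n) powr (1 - s) :: complex)) \<longlonglongrightarrow> 0"
      by (simp add: norm_powr_real_powr del: of_nat_Suc)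
  qed
  then have "(\<lambda>n. of_nat (Suc (Suc n)) powr (1 - s) - of_nat (Suc n) powr (1 - s)) sums
                (0 - of_nat (Suc 0) powr (1 - s) :: complex)"
    by (rule telescope_sums)
  moreover have "(\<lambda>n. \<Sum>i=1..K. ((1 - s) gchoose i) * (1 / of_nat (Suc n) powr (s + of_nat i - 1))) sums
        (\<Sum>i=1..K. ((1 - s) gchoose i) * dseries (s + of_nat i - 1))"
    using s by (intro sums_sum sums_mult dseries_sums) auto
  ultimately have "(\<lambda>n. of_nat (Suc (Suc n)) powr (1 - s) - of_nat (Suc n) powr (1 - s) -
       (\<Sum>i=1..K. ((1 - s) gchoose i) * (1 / of_nat (Suc n) powr (s + of_nat i - 1)))) sums
       (0 - of_nat (Suc 0) powr (1 - s) - (\<Sum>i=1..K. ((1 - s) gchoose i) * dseries (s + of_nat i - 1)))"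
    by (rule sums_diff)
  also have "(\<lambda>n. of_nat (Suc (Suc n)) powr (1 - s) - of_nat (Suc n) powr (1 - s) -
       (\<Sum>i=1..K. ((1 - s) gchoose i) * (1 / of_nat (Suc n) powr (s + of_nat i - 1)))) =
       (\<lambda>n. taylor_rem K (Suc n) s)"
  proof
    fix n
    have "1 / of_nat (Suc n) powr (s + of_nat i - 1) = (of_nat (Suc n) powr (1 - s - of_nat i) :: complex)" for i
      by (simp add: powr_minus_divide [symmetric] algebra_simps del: of_nat_Suc)
    moreover have "{..K} = insert 0 {1..K}" by auto
    ultimately show "of_nat (Suc (Suc n)) powr (1 - s) - of_nat (Suc n) powr (1 - s) -
       (\<Sum>i=1..K. ((1 - s) gchoose i) * (1 / of_nat (Suc n) powr (s + of_nat i - 1))) = taylor_rem K (Suc n) s"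
      by (simp add: taylor_rem_def del: of_nat_Suc)
  qed
  finally show ?thesis by (simp add: sums_iff)
qed

lemma holomorphic_on_dseries: "dseries holomorphic_on {s. Re s > 1}"
proof -
  have "(\<lambda>s. \<Sum>n. 1 / of_nat (Suc n) powr s :: complex) holomorphic_on {s. Re s > 1}"
  proof (rule holomorphic_on_suminf)
    show "open {s. Re s > 1}" by (simp add: open_halfspace_Re_gt)
    show "(\<lambda>s. 1 / of_nat (Suc n) powr s :: complex) holomorphic_on {s. Re s > 1}" for n
      by (intro holomorphic_intros powr_holomorphic_exponent) auto
    fix x assume x: "x \<in> {s. Re s > 1}"
    define d where "d = (Re x - 1) / 2"
    have d: "d > 0" using x by (simp add: d_def)
    have Re: "Re y \<ge> 1 + d" if "y \<in> cball x d" for y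
    proof -
      have "\<bar>Re (x - y)\<bar> \<le> d" using that abs_Re_le_cmod[of "x - y"] by (simp add: dist_norm)
      then have "Re x - Re y \<le> d" by simp
      then show ?thesis unfolding d_def by (simp add: field_simps)
    qed
    have "summable (\<lambda>n. real (Suc n) powr (- (1 + d)))"
      using d by (subst summable_Suc_iff) (simp add: summable_real_powr_iff)
    moreover have "norm (1 / of_nat (Suc n) powr y :: complex) \<le> real (Suc n) powr (- (1 + d))"
      if "y \<in> cball x d" for n y
      unfolding norm_dseries_term using Re[OF that] by (intro powr_mono) auto
    moreover have "cball x d \<subseteq> {s. Re s > 1}" using Re d by fastforce
    ultimately show "\<exists>d>0. \<exists>M. cball x d \<subseteq> {s. Re s > 1} \<and> summable M \<and>
                  (\<forall>n. \<forall>y\<in>cball x d. norm (1 / of_nat (Suc n) powr y :: complex) \<le> M n)"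
      using d by blast
  qed
  then show ?thesis by (simp add: dseries_def [abs_def])
qed

text \<open>Telescoping \<open>(n + 1) powr (1 - s) - n powr (1 - s)\<close> over \<open>n\<close> and expanding each difference by
  Taylor's formula expresses \<open>(s - 1) * \<zeta>(s)\<close> through the values at \<open>s + 1, \<dots>, s + K\<close> and a
  remainder that converges one unit further to the left.\<close>

lemma dseries_continuation_strip:
  "\<exists>Z. Z holomorphic_on {s. Re s > 1 - real K} \<and> (\<forall>s. Re s > 1 \<longrightarrow> Z s = (s - 1) * dseries s)"
proof (induction K)
  case 0
  have "(\<lambda>s. (s - 1) * dseries s) holomorphic_on {s. Re s > 1}"
    by (intro holomorphic_intros holomorphic_on_dseries)
  then show ?case by (intro exI[of _ "\<lambda>s. (s - 1) * dseries s"]) simp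
next
  case (Suc K)
  then obtain Z where Z: "Z holomorphic_on {s. Re s > 1 - real K}"
     "\<And>s. Re s > 1 \<Longrightarrow> Z s = (s - 1) * dseries s" by blast
  \<comment> \<open>The identity \<open>suminf_taylor_rem\<close> solved for
    \<open>(s - 1) * dseries s\<close>. Since \<open>(1 - s) gchoose Suc i\<close> contains the
    factor \<open>- (s + i - 1)\<close>, each shifted value \<open>dseries (s + i)\<close> carries
    exactly what turns it into \<open>Z (s + i)\<close>, free of its pole.\<close>
  define Z' where "Z' = (\<lambda>s. 1 + (\<Sum>n. taylor_rem (Suc K) (Suc n) s)
      - (\<Sum>i=1..K. ((1 - s) gchoose i) / of_nat (Suc i) * Z (s + of_nat i)))"
  have "(\<lambda>s. Z (s + of_nat i)) holomorphic_on {s. Re s > 1 - real (Suc K)}" if "i \<in> {1..K}" for i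
  proof -
    have "(Z \<circ> (\<lambda>s. s + of_nat i)) holomorphic_on {s. Re s > 1 - real (Suc K)}"
      using that by (intro holomorphic_on_compose_gen[OF _ Z(1)] holomorphic_intros) auto
    then show ?thesis by (simp add: o_def)
  qed
  then have "Z' holomorphic_on {s. Re s > 1 - real (Suc K)}"
    unfolding Z'_def gbinomial_prod_rev
    by (intro holomorphic_intros holomorphic_on_suminf_taylor_rem) (auto simp del: of_nat_Suc)
  moreover have "Z' s = (s - 1) * dseries s" if s: "Re s > 1" for s
  proof -
    have "(\<Sum>i=1..Suc K. ((1 - s) gchoose i) * dseries (s + of_nat i - 1)) =
      (1 - s) * dseries s + (\<Sum>i=1..K. ((1 - s) gchoose Suc i) * dseries (s + of_nat i))"
      unfolding sum.atLeast_Suc_atMost[of 1 "Suc K", simplified] One_nat_def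
        sum.atLeast_Suc_atMost_Suc_shift by (simp add: o_def add_ac sum.atLeast_Suc_atMost[of 0 K])
    moreover have "((1 - s) gchoose i) / of_nat (Suc i) * Z (s + of_nat i) =
                     - (((1 - s) gchoose Suc i) * dseries (s + of_nat i))" for i
    proof -
      have "of_nat (Suc i) * ((1 - s) gchoose Suc i) = (1 - s - of_nat i) * ((1 - s) gchoose i)"
        using gbinomial_mult_1[of "1 - s" i] by (simp add: algebra_simps)
      then have "((1 - s) gchoose Suc i) = (1 - s - of_nat i) * ((1 - s) gchoose i) / of_nat (Suc i)"
        by (metis nonzero_mult_div_cancel_left of_nat_neq_0)
      moreover have "Z (s + of_nat i) = (s + of_nat i - 1) * dseries (s + of_nat i)"
        using s by (intro Z(2)) simp
      moreover have "1 - s - of_nat i = - (s + of_nat i - 1)" by simp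
      ultimately show ?thesis
        by (simp only: mult_minus_left mult_minus_right minus_divide_left [symmetric]
            times_divide_eq_left times_divide_eq_right mult_ac minus_minus)
    qed
    ultimately show ?thesis
      unfolding Z'_def suminf_taylor_rem[OF s] by (simp add: sum_negf algebra_simps)
  qed
  ultimately show ?case by blast
qed

text \<open>By the identity theorem the functions on two half-planes agree on the smaller one, so
  the value at \<open>s\<close> does not depend on the half-plane chosen, and near each point a
  single one of these functions serves.\<close>

lemma entire_dseries_continuation:
  "\<exists>Z. Z holomorphic_on UNIV \<and> (\<forall>s. Re s > 1 \<longrightarrow> Z s = (s - 1) * dseries s)"
proof -
  obtain Z where Z: "\<And>K. Z K holomorphic_on {s. Re s > 1 - real K}"
     "\<And>K s. Re s > 1 \<Longrightarrow> Z K s = (s - 1) * dseries s"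
    using dseries_continuation_strip by metis
  have eq: "Z K s = Z L s" if "Re s > 1 - real K" "K \<le> L" for K L s
  proof (rule analytic_continuation_open[where s = "{s. Re s > 1}" and s' = "{s. Re s > 1 - real K}"
           and f = "Z K" and g = "Z L"])
    show "{s. Re s > 1} \<noteq> {}" by (auto intro!: exI[of _ "2 :: complex"])
    show "Z L holomorphic_on {s. Re s > 1 - real K}"
      using that by (intro holomorphic_on_subset[OF Z(1)]) auto
    show "connected {s. Re s > 1 - real K}"
      by (intro convex_connected convex_halfspace_Re_gt)
  qed (use that Z in \<open>auto simp: open_halfspace_Re_gt\<close>)
  define idx where "idx = (\<lambda>s. nat \<lceil>2 - Re s\<rceil>)"
  have idx: "Re s > 1 - real (idx s)" for s unfolding idx_def by linarith
  define Z' where "Z' = (\<lambda>s. Z (idx s) s)"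
  have Z': "Z' s = Z K s" if "Re s > 1 - real K" for s K
  proof (cases "idx s \<le> K")
    case True
    show ?thesis unfolding Z'_def by (rule eq[OF idx True])
  next
    case False
    then have "K \<le> idx s" by simp
    from eq[OF that this] show ?thesis unfolding Z'_def by (rule sym)
  qed
  have "Z' field_differentiable at s" for s
  proof -
    have o: "open {t. Re t > 1 - real (idx s)}" by (simp add: open_halfspace_Re_gt)
    have "Z' holomorphic_on {t. Re t > 1 - real (idx s)}"
      by (rule holomorphic_transform[OF Z(1)], rule Z'[symmetric]) simp
    then show ?thesis using o idx by (auto simp: holomorphic_on_open field_differentiable_def)
  qed
  then have "Z' holomorphic_on UNIV"
    by (simp add: holomorphic_on_def field_differentiable_at_within)
  moreover have "Z' s = (s - 1) * dseries s" if "Re s > 1" for s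
    using Z(2) that by (simp add: Z'_def)
  ultimately show ?thesis by blast
qed

text \<open>\<open>someI_ex\<close> needs a witness; it is \<open>Z s / (s - 1)\<close> with the
  entire function just constructed.\<close>

lemma
  shows holomorphic_on_zeta: "zeta holomorphic_on - {1}"
    and zeta_sums: "\<And>s. Re s > 1 \<Longrightarrow> (\<lambda>n. 1 / of_nat (Suc n) powr s) sums zeta s"
proof -
  obtain Z where Z: "Z holomorphic_on UNIV" "\<And>s. Re s > 1 \<Longrightarrow> Z s = (s - 1) * dseries s"
    using entire_dseries_continuation by blast
  have "(\<lambda>s. Z s / (s - 1)) holomorphic_on - {1}"
    by (intro holomorphic_intros holomorphic_on_subset[OF Z(1)]) auto
  moreover have "(\<lambda>n. 1 / of_nat (Suc n) powr s) sums (Z s / (s - 1))" if "Re s > 1" for s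
  proof -
    have "s \<noteq> 1" using that by auto
    then show ?thesis using dseries_sums[OF that] Z(2)[OF that] by simp
  qed
  ultimately have "\<exists>h. h holomorphic_on (- {1}) \<and>
             (\<forall>s. Re s > 1 \<longrightarrow> (\<lambda>n. 1 / of_nat (Suc n) powr s) sums h s)" by blast
  then have "zeta holomorphic_on (- {1}) \<and>
             (\<forall>s. Re s > 1 \<longrightarrow> (\<lambda>n. 1 / of_nat (Suc n) powr s) sums zeta s)"
    unfolding zeta_def by (rule someI_ex)
  then show "zeta holomorphic_on - {1}" "\<And>s. Re s > 1 \<Longrightarrow> (\<lambda>n. 1 / of_nat (Suc n) powr s) sums zeta s"
    by blast+
qed

lemma zeta_eq_dseries: "Re s > 1 \<Longrightarrow> zeta s = dseries s"
  by (rule sums_unique2[OF zeta_sums dseries_sums])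

lemma zeta_continuation:
  assumes "Z holomorphic_on A" "open A" "connected A" "{s. Re s > 1} \<subseteq> A"
    and "\<And>s. Re s > 1 \<Longrightarrow> Z s = (s - 1) * zeta s" and "s \<in> A" "s \<noteq> 1"
  shows "Z s = (s - 1) * zeta s"
proof (rule analytic_continuation_open[where s = "{s. Re s > 1}" and s' = "A - {1}"
           and f = Z and g = "\<lambda>s. (s - 1) * zeta s"])
  have "2 \<in> {s. Re s > 1}" by simp
  then show "{s. Re s > 1} \<noteq> {}" by blast
  show "connected (A - {1})" using assms by (intro connected_open_delete) auto
  show "Z holomorphic_on A - {1}" using assms(1) by (rule holomorphic_on_subset) auto
  show "(\<lambda>s. (s - 1) * zeta s) holomorphic_on A - {1}"
    by (intro holomorphic_intros holomorphic_on_subset[OF holomorphic_on_zeta]) auto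
  show "{s. Re s > 1} \<subseteq> A - {1}" using assms(4) by auto
  show "open (A - {1})" using assms(2) by (rule open_delete)
  show "s \<in> A - {1}" using assms(6,7) by blast
  show "Z z = (z - 1) * zeta z" if "z \<in> {s. Re s > 1}" for z using assms(5) that by blast
qed (simp add: open_halfspace_Re_gt)

lemma entire_zeta_mult:
  obtains Z where "Z holomorphic_on UNIV" "\<And>s. s \<noteq> 1 \<Longrightarrow> Z s = (s - 1) * zeta s"
proof -
  obtain Z where Z: "Z holomorphic_on UNIV" "\<And>s. Re s > 1 \<Longrightarrow> Z s = (s - 1) * dseries s"
    using entire_dseries_continuation by blast
  have "Z s = (s - 1) * zeta s" if "s \<noteq> 1" for s
  proof (rule zeta_continuation[OF Z(1)])
    show "Z t = (t - 1) * zeta t" if "Re t > 1" for t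
      unfolding Z(2)[OF that] zeta_eq_dseries[OF that] ..
  qed (use that in auto)
  with Z(1) show ?thesis by (rule that)
qed

text \<open>For \<open>K = 1\<close> the only term left after telescoping is
  \<open>(1 - s) * dseries s\<close>: no shifted values of zeta occur, and the remainder alone
  controls zeta on \<open>Re s > 0\<close>.\<close>

lemma zeta_mult_eq_taylor_rem:
  assumes "Re s > 0" "s \<noteq> 1"
  shows "(s - 1) * zeta s = 1 + (\<Sum>n. taylor_rem 1 (Suc n) s)"
proof -
  define W where "W = (\<lambda>s. 1 + (\<Sum>n. taylor_rem 1 (Suc n) s))"
  have hol: "W holomorphic_on {s. Re s > 0}"
    using holomorphic_on_suminf_taylor_rem[of 1] unfolding W_def
    by (intro holomorphic_on_add holomorphic_on_const) (simp only: of_nat_1 diff_self)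
  have eq: "W s = (s - 1) * zeta s" if "Re s > 1" for s
  proof -
    have "(\<Sum>i=1..(1::nat). ((1 - s) gchoose i) * dseries (s + of_nat i - 1)) = (1 - s) * dseries s"
      by simp
    then show ?thesis
      unfolding W_def suminf_taylor_rem[OF that] zeta_eq_dseries[OF that]
      by (simp only:) (simp add: left_diff_distrib)
  qed
  have "W s = (s - 1) * zeta s"
    using assms by (intro zeta_continuation[OF hol _ _ _ eq])
      (auto simp: open_halfspace_Re_gt intro: convex_connected convex_halfspace_Re_gt)
  then show ?thesis by (simp only: W_def)
qed

text \<open>The square comes from the factor \<open>(1 - s) * (- s)\<close> of the second
  derivative. The line \<open>Re s = 1/4\<close> keeps the exponents at most -5/4 and is the left
  edge of the disc of radius 7/4 about \<open>2 + i T\<close> to which Jensen's inequality is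
  applied.\<close>

lemma zeta_mult_bound:
  obtains C where "C > 0" "\<And>s. Re s \<ge> 1/4 \<Longrightarrow> s \<noteq> 1 \<Longrightarrow> norm ((s - 1) * zeta s) \<le> C * (1 + norm s) ^ 2"
proof -
  define D where "D = (\<Sum>n. real (Suc n) powr (- 5/4))"
  have sm: "summable (\<lambda>n. real (Suc n) powr (- 5/4))"
    by (subst summable_Suc_iff) (simp add: summable_real_powr_iff)
  have "D \<ge> 0" unfolding D_def by (intro suminf_nonneg sm) auto
  have "norm ((s - 1) * zeta s) \<le> (1 + D) * (1 + norm s) ^ 2" if s: "Re s \<ge> 1/4" "s \<noteq> 1" for s
  proof -
    have "fact (Suc 1) * ((1 - s) gchoose Suc 1) = (1 - s) * (- s)"
      by (simp add: gbinomial_prod_rev)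
    then have "norm (fact (Suc 1) * ((1 - s) gchoose Suc 1)) = norm (1 - s) * norm s"
      by (simp only: norm_mult norm_minus_cancel)
    also have "\<dots> \<le> (1 + norm s) * (1 + norm s)"
      using norm_triangle_ineq4[of 1 s] by (intro mult_mono) auto
    finally have le: "norm (fact (Suc 1) * ((1 - s) gchoose Suc 1)) \<le> (1 + norm s)^2"
      by (simp add: power2_eq_square)
    have bd: "norm (taylor_rem 1 (Suc n) s) \<le> (1 + norm s) ^ 2 * real (Suc n) powr (-5/4)" for n
    proof -
      have "norm (taylor_rem 1 (Suc n) s) \<le> norm (fact (Suc 1) * ((1 - s) gchoose Suc 1)) 
              * real (Suc n) powr (- Re s - real 1)"
        using s by (intro taylor_rem_bound) auto
      also have "\<dots> \<le> (1 + norm s) ^ 2 * real (Suc n) powr (-5/4)"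
        using s le by (intro mult_mono powr_mono) auto
      finally show ?thesis .
    qed
    have "norm (\<Sum>n. taylor_rem 1 (Suc n) s) \<le> (\<Sum>n. (1 + norm s) ^ 2 * real (Suc n) powr (-5/4))"
      using bd by (intro norm_suminf_le summable_mult sm)
    also have "\<dots> = (1 + norm s)^2 * D" unfolding D_def by (intro suminf_mult sm)
    finally have "norm (1 + (\<Sum>n. taylor_rem 1 (Suc n) s)) \<le> 1 + (1 + norm s)^2 * D"
      using norm_triangle_ineq[of 1 "\<Sum>n. taylor_rem 1 (Suc n) s"] by simp
    also have "\<dots> \<le> (1 + norm s)^2 + (1 + norm s)^2 * D"
      using one_le_power[of "1 + norm s" 2] by simp
    finally have "norm (1 + (\<Sum>n. taylor_rem 1 (Suc n) s)) \<le> (1 + D) * (1 + norm s) ^ 2"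
      by (simp add: algebra_simps)
    then show ?thesis using zeta_mult_eq_taylor_rem[of s] s by simp
  qed
  then show ?thesis using \<open>D \<ge> 0\<close> by (intro that[of "1 + D"]) auto
qed

subsection \<open>Zeros in a disc and variation of the argument\<close>

text \<open>Schwarz's lemma asks for the strict bound 1, so \<open>g\<close> is divided by an
  arbitrary \<open>B > M\<close>, and \<open>B\<close> is then lowered to \<open>M\<close>. The
  point 0 is covered by the bound on the derivative.\<close>

lemma Schwarz_quotient:
  assumes hol: "g holomorphic_on ball 0 1" and 0: "g 0 = 0"
    and bd: "\<And>z. norm z < 1 \<Longrightarrow> norm (g z) \<le> M" and M: "M \<ge> 0"
  obtains h where "h holomorphic_on ball 0 1" "\<And>z. norm z < 1 \<Longrightarrow> g z = z * h z"
    "\<And>z. norm z < 1 \<Longrightarrow> norm (h z) \<le> M"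
proof -
  obtain h where h: "h holomorphic_on ball 0 1" "\<And>z. norm z < 1 \<Longrightarrow> g z = z * h z"
      "deriv g 0 = h 0"
    using Schwarz3[OF hol 0] by metis
  have "norm (h z) \<le> M" if z: "norm z < 1" for z
  proof (rule dense_ge)
    fix B assume B: "M < B"
    have B0: "B > 0" using M B by linarith
    define k where "k = (\<lambda>z. g z / of_real B)"
    have kh: "k holomorphic_on ball 0 1" unfolding k_def
      using B0 by (intro holomorphic_intros hol) auto
    have k0: "k 0 = 0" using 0 by (simp add: k_def)
    have k1: "norm (k z) < 1" if "norm z < 1" for z
      using bd[OF that] B B0 by (simp add: k_def norm_divide)
    show "norm (h z) \<le> B"
    proof (cases "z = 0")
      case True
      have "deriv k 0 = deriv g 0 / of_real B"
        unfolding k_def using hol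
        by (intro deriv_cdivide_right) (auto intro: holomorphic_on_imp_differentiable_at)
      then have "norm (h 0 / of_real B) \<le> 1" using Schwarz_Lemma(2)[OF kh k0 k1 z] h(3) by simp
      then show ?thesis using True B0 by (simp add: norm_divide field_simps)
    next
      case False
      have "norm (k z) \<le> norm z" by (rule Schwarz_Lemma(1)[OF kh k0 k1 z])
      then have "norm z * (norm (h z) / B) \<le> norm z * 1"
        using h(2)[OF z] B0 by (simp add: k_def norm_divide norm_mult)
      then have "norm (h z) / B \<le> 1" using False by (metis mult_le_cancel_left_pos zero_less_norm_iff)
      then show ?thesis using B0 by simp
    qed
  qed
  with h(1,2) show ?thesis by (rule that)
qed

text \<open>Jensen's inequality in product form: divide out one Blaschke factor per zero.\<close>

lemma unit_disc_zeros_bound: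
  assumes "finite A" and "g holomorphic_on ball 0 1"
    and "\<And>z. norm z < 1 \<Longrightarrow> norm (g z) \<le> M" and "\<And>a. a \<in> A \<Longrightarrow> norm a \<le> q \<and> g a = 0"
    and q: "0 \<le> q" "q < 1"
  shows "norm (g 0) \<le> M * q ^ card A"
  using assms(1-4)
proof (induction A arbitrary: g rule: finite_induct)
  case empty
  then show ?case by simp
next
  case (insert a A)
  have a: "norm a < 1" "norm a \<le> q" "g a = 0" using insert.prems(3)[of a] q by auto
  have M: "M \<ge> 0" using insert.prems(2)[of 0] norm_ge_zero[of "g 0"] by (metis norm_zero order_trans zero_less_one)
  have ma: "norm (- a) < 1" using a by simp
  \<comment> \<open>\<open>?p\<close> sends \<open>a\<close> to 0 and \<open>?m\<close> inverts it.
    Hence \<open>g\<close> composed with \<open>?m\<close> vanishes at 0, and pulling its quotient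
    by \<open>z\<close> back along \<open>?p\<close> gives \<open>k\<close> with
    \<open>g = ?p * k\<close> and the same bound \<open>M\<close>; at 0 the factor \<open>?p\<close>
    has modulus \<open>norm a\<close>.\<close>
  let ?p = "Moebius_function 0 a" and ?m = "Moebius_function 0 (- a)"
  have pm: "?m (?p z) = z" if "norm z < 1" for z
    by (rule Moebius_function_compose) (use a that in auto)
  have hol: "(g \<circ> ?m) holomorphic_on ball 0 1"
    by (rule holomorphic_on_compose_gen[OF Moebius_function_holomorphic[OF ma] insert.prems(1)])
      (use Moebius_function_norm_lt_1[OF ma] in auto)
  have z0: "(g \<circ> ?m) 0 = 0" using a(3) by (simp add: Moebius_function_of_zero)
  have bd: "norm ((g \<circ> ?m) z) \<le> M" if "norm z < 1" for z
    using insert.prems(2)[OF Moebius_function_norm_lt_1[OF ma that, of 0]] by simp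
  obtain h where h: "h holomorphic_on ball 0 1" "\<And>z. norm z < 1 \<Longrightarrow> (g \<circ> ?m) z = z * h z"
    "\<And>z. norm z < 1 \<Longrightarrow> norm (h z) \<le> M"
    using Schwarz_quotient[OF hol z0 bd M] by metis
  define k where "k = h \<circ> ?p"
  have kh: "k holomorphic_on ball 0 1" unfolding k_def
    by (rule holomorphic_on_compose_gen[OF Moebius_function_holomorphic[OF a(1)] h(1)])
      (use Moebius_function_norm_lt_1[OF a(1)] in auto)
  have kb: "norm (k z) \<le> M" if "norm z < 1" for z
    using h(3)[OF Moebius_function_norm_lt_1[OF a(1) that, of 0]] by (simp add: k_def)
  have gk: "g z = ?p z * k z" if "norm z < 1" for z
    using h(2)[OF Moebius_function_norm_lt_1[OF a(1) that, of 0]] pm[OF that] by (simp add: k_def)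
  have kA: "norm b \<le> q \<and> k b = 0" if "b \<in> A" for b
  proof -
    have b: "norm b \<le> q" "g b = 0" using insert.prems(3)[of b] that by auto
    have b1: "norm b < 1" using b q by simp
    have "?p b \<noteq> 0"
    proof
      assume "?p b = 0"
      then have "b = ?m 0" using pm[OF b1] by simp
      then show False using \<open>a \<notin> A\<close> \<open>b \<in> A\<close> by (simp add: Moebius_function_of_zero)
    qed
    then show ?thesis using gk[OF b1] b by simp
  qed
  have "norm (g 0) = norm a * norm (k 0)"
    using gk[of 0] by (simp add: Moebius_function_of_zero norm_mult)
  also have "\<dots> \<le> q * (M * q ^ card A)"
    using a(2) insert.IH[OF kh kb kA] q by (intro mult_mono) auto
  finally show ?case using insert.hyps by (simp add: mult_ac)
qed

lemma disc_zeros_bound: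
  assumes "finite A" and hol: "g holomorphic_on ball w R"
    and bd: "\<And>z. z \<in> ball w R \<Longrightarrow> norm (g z) \<le> M" and A: "\<And>a. a \<in> A \<Longrightarrow> a \<in> cball w r \<and> g a = 0"
    and r: "0 \<le> r" "r < R"
  shows "norm (g w) \<le> M * (r / R) ^ card A"
proof -
  define l where "l = (\<lambda>z. w + of_real R * z)"
  define B where "B = (\<lambda>a. (a - w) / of_real R) ` A"
  have R: "R > 0" using r by simp
  have l: "l z \<in> ball w R" if "norm z < 1" for z
    using that R by (simp add: l_def dist_norm norm_mult)
  have "norm ((g \<circ> l) 0) \<le> M * (r / R) ^ card B"
  proof (rule unit_disc_zeros_bound)
    show "finite B" using \<open>finite A\<close> by (simp add: B_def)
    have "l holomorphic_on ball 0 1" unfolding l_def by (intro holomorphic_intros)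
    then show "(g \<circ> l) holomorphic_on ball 0 1"
      by (rule holomorphic_on_compose_gen[OF _ hol]) (use l in auto)
    show "norm ((g \<circ> l) z) \<le> M" if "norm z < 1" for z using bd[OF l[OF that]] by simp
    fix b assume "b \<in> B"
    then obtain a where a: "a \<in> A" "b = (a - w) / of_real R" by (auto simp: B_def)
    have "l b = a" using a R by (simp add: l_def)
    moreover have "norm b \<le> r / R"
      using A[OF a(1)] R a(2) by (simp add: norm_divide dist_norm norm_minus_commute divide_right_mono)
    ultimately show "norm b \<le> r / R \<and> (g \<circ> l) b = 0" using A[OF a(1)] by simp
  qed (use r in auto)
  moreover have "card B = card A"
    unfolding B_def using R by (intro card_image inj_onI) simp
  ultimately show ?thesis by (simp add: l_def)
qed

text \<open>Wherever the argument \<open>\<phi>\<close> is an odd multiple of \<open>pi / 2\<close>, the real part of \<open>h\<close> vanishes; on the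
  real axis it agrees with the holomorphic function \<open>(h z + cnj (h (cnj z))) / 2\<close>.\<close>

lemma real_axis_arg_variation:
  fixes h :: "complex \<Rightarrow> complex" and x l R v M :: real
  assumes hol: "h holomorphic_on ball (of_real x) R"
    and bd: "\<And>z. z \<in> ball (of_real x) R \<Longrightarrow> norm (h z) \<le> M"
    and l: "0 < l" "l < R" and v: "h (of_real x) = of_real v" "v \<ge> 0"
    and \<phi>: "continuous_on {0..1} \<phi>" "\<phi> 0 = 0"
    and h\<phi>: "\<And>t. t \<in> {0..1} \<Longrightarrow> h (of_real (x - l * t)) = of_real (norm (h (of_real (x - l * t)))) * cis (\<phi> t)"
    and N: "real N * pi \<le> \<bar>\<phi> 1\<bar>"
  shows "v \<le> M * (l / R) ^ N"
proof -
  let ?B = "ball (of_real x) R :: complex set"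
  define g where "g = (\<lambda>z. (h z + cnj (h (cnj z))) / 2)"
  have cnjB: "cnj z \<in> ?B" if "z \<in> ?B" for z
    using that by (metis complex_cnj_complex_of_real complex_cnj_diff complex_mod_cnj dist_norm mem_ball)
  have "cnj ` ?B = ?B" using cnjB by (metis (no_types, opaque_lifting) complex_cnj_cnj image_eqI image_subsetI subsetI subset_antisym)
  then have "(cnj \<circ> h \<circ> cnj) holomorphic_on ?B"
    using hol by (intro holomorphic_on_compose_cnj_cnj) auto
  then have gh: "g holomorphic_on ?B"
    unfolding g_def o_def by (intro holomorphic_intros hol) auto
  have gb: "norm (g z) \<le> M" if "z \<in> ?B" for z
  proof -
    have "norm (h z + cnj (h (cnj z))) \<le> M + M"
      using norm_triangle_ineq[of "h z" "cnj (h (cnj z))"] bd[OF that] bd[OF cnjB[OF that]] by simp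
    then show ?thesis by (simp add: g_def norm_divide)
  qed
  have g_real: "g (of_real y) = of_real (Re (h (of_real y)))" for y
    by (simp add: g_def complex_add_cnj)
  \<comment> \<open>The modulus of \<open>\<phi>\<close> goes from 0 to at least
    \<open>N * pi\<close> and so meets all \<open>N\<close> values \<open>pi / 2 + k * pi\<close>.
    Distinct values force distinct parameters, hence distinct zeros of \<open>g\<close> within
    distance \<open>l\<close> of \<open>x\<close>.\<close>
  have "\<exists>t\<in>{0..1}. \<bar>\<phi> t\<bar> = pi / 2 + real k * pi" if "k < N" for k
  proof -
    have "real k + 1/2 \<le> real N" using that by linarith
    then have "(real k + 1/2) * pi \<le> real N * pi" by (intro mult_right_mono) auto
    then have "pi / 2 + real k * pi \<le> \<bar>\<phi> 1\<bar>" using N by (simp add: algebra_simps)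
    moreover have "continuous_on {0..1} (\<lambda>t. \<bar>\<phi> t\<bar>)" using \<phi>(1) by (intro continuous_intros)
    ultimately show ?thesis
      using IVT'[of "\<lambda>t. \<bar>\<phi> t\<bar>" 0 "pi / 2 + real k * pi" 1] \<phi>(2) by auto
  qed
  then obtain t where t: "\<And>k. k < N \<Longrightarrow> t k \<in> {0..1}" "\<And>k. k < N \<Longrightarrow> \<bar>\<phi> (t k)\<bar> = pi / 2 + real k * pi"
    by metis
  define a where "a = (\<lambda>k. complex_of_real (x - l * t k))"
  have "inj_on a {..<N}"
  proof (rule inj_onI)
    fix j k assume jk: "j \<in> {..<N}" "k \<in> {..<N}" "a j = a k"
    then have "t j = t k" using l by (simp add: a_def)
    then have "pi / 2 + real j * pi = pi / 2 + real k * pi"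
      using t(2)[of j] t(2)[of k] jk(1,2) by (metis lessThan_iff)
    then show "j = k" by simp
  qed
  then have card: "card (a ` {..<N}) = N" by (simp add: card_image)
  have zero: "g (a k) = 0" if "k < N" for k
  proof -
    have "cos (\<phi> (t k)) = cos \<bar>\<phi> (t k)\<bar>" by (simp add: abs_if)
    also have "\<dots> = 0" unfolding t(2)[OF that]
      by (simp add: cos_add sin_npi mult.commute)
    finally have "cos (\<phi> (t k)) = 0" .
    moreover have "Re (of_real r * cis y) = r * cos y" for r y by simp
    ultimately have "Re (h (a k)) = 0"
      using arg_cong[OF h\<phi>[OF t(1)[OF that]], of Re] unfolding a_def by (metis mult_zero_right)
    then show ?thesis unfolding a_def g_real by simp
  qed
  have "norm (g (of_real x)) \<le> M * (l / R) ^ card (a ` {..<N})"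
  proof (rule disc_zeros_bound[OF _ gh gb])
    fix z assume "z \<in> a ` {..<N}"
    then obtain k where k: "k < N" "z = a k" by auto
    have "norm (of_real x - a k) = norm (complex_of_real (l * t k))" unfolding a_def by simp
    also have "\<dots> = l * t k" unfolding norm_of_real using t(1)[OF k(1)] l by simp
    also have "\<dots> \<le> l" using t(1)[OF k(1)] l by (simp add: mult_left_le)
    finally show "z \<in> cball (of_real x) l \<and> g z = 0" using zero k by (simp add: dist_norm)
  qed (use l in auto)
  then show ?thesis using g_real[of x] v card by simp
qed

text \<open>Two branches differ by a multiple of \<open>2 * pi\<close> wherever \<open>g\<close> is
  nonzero. If they ended differently, the modulus of the difference would pass through
  \<open>pi\<close> on the way, where \<open>cis\<close> of the difference is -1 and not 1.\<close>

lemma arg_along_eqI: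
  assumes \<phi>: "continuous_on {0..1} \<phi>" "\<phi> 0 = 0"
    and g\<phi>: "\<And>t. t \<in> {0..1} \<Longrightarrow> g (p t) = of_real (norm (g (p t))) * cis (\<phi> t)"
    and nz: "\<And>t. t \<in> {0..1} \<Longrightarrow> g (p t) \<noteq> 0"
  shows "arg_along g p = \<phi> 1"
  unfolding arg_along_def
proof (rule the_equality)
  show "\<exists>\<psi>. continuous_on {0..1} \<psi> \<and> \<psi> 0 = 0 \<and> \<psi> 1 = \<phi> 1 \<and>
     (\<forall>t\<in>{0..1}. g (p t) = of_real (cmod (g (p t))) * cis (\<psi> t))"
    using \<phi> g\<phi> by blast
next
  fix a
  assume "\<exists>\<psi>. continuous_on {0..1} \<psi> \<and> \<psi> 0 = 0 \<and> \<psi> 1 = a \<and>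
     (\<forall>t\<in>{0..1}. g (p t) = of_real (cmod (g (p t))) * cis (\<psi> t))"
  then obtain \<psi> where \<psi>: "continuous_on {0..1} \<psi>" "\<psi> 0 = 0" "\<psi> 1 = a"
    and g\<psi>: "\<And>t. t \<in> {0..1} \<Longrightarrow> g (p t) = of_real (norm (g (p t))) * cis (\<psi> t)"
    by blast
  define d where "d = (\<lambda>t. \<bar>\<psi> t - \<phi> t\<bar>)"
  have cis_d: "cis (\<psi> t - \<phi> t) = 1" if "t \<in> {0..1}" for t
  proof -
    have "of_real (norm (g (p t))) * cis (\<psi> t) = of_real (norm (g (p t))) * cis (\<phi> t)"
      using g\<phi>[OF that] g\<psi>[OF that] by simp
    then have "cis (\<psi> t) = cis (\<phi> t)" using nz[OF that] by simp
    then show ?thesis by (simp flip: cis_divide)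
  qed
  show "a = \<phi> 1"
  proof (rule ccontr)
    assume "a \<noteq> \<phi> 1"
    have "cos (d 1) = 1"
      using cis_d[of 1] unfolding d_def cos_abs_real by (simp add: complex_eq_iff)
    then obtain n :: int where n: "d 1 = of_int n * 2 * pi" using cos_one_2pi_int by auto
    have "d 1 > 0" using \<open>a \<noteq> \<phi> 1\<close> \<psi>(3) by (simp add: d_def)
    then have "n \<ge> 1" unfolding n by (simp add: zero_less_mult_iff)
    then have "real_of_int n * (2 * pi) \<ge> 1 * (2 * pi)" by (intro mult_right_mono) auto
    then have "pi \<le> d 1" unfolding n using pi_gt_zero by (simp add: mult.assoc)
    moreover have "continuous_on {0..1} d" unfolding d_def by (intro continuous_intros \<phi> \<psi>)
    moreover have "d 0 \<le> pi" using \<phi> \<psi> by (simp add: d_def)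
    ultimately obtain t where t: "t \<in> {0..1}" "d t = pi" using IVT'[of d 0 pi 1] by auto
    have "cos (d t) = Re (cis (\<psi> t - \<phi> t))" unfolding d_def cos_abs_real by simp
    then show False using cis_d[OF t(1)] t(2) by simp
  qed
qed

text \<open>A continuous logarithm exists because the interval is contractible. Its imaginary part
  is shifted to start at 0; positivity of \<open>k 0\<close> makes the shift a multiple of
  \<open>2 * pi\<close>, which \<open>cis\<close> ignores.\<close>

lemma continuous_argument_exists:
  fixes k :: "real \<Rightarrow> complex"
  assumes "continuous_on {0..1} k" and "\<And>t. t \<in> {0..1} \<Longrightarrow> k t \<noteq> 0" and v: "k 0 = of_real v" "v > 0"
  obtains \<phi> where "continuous_on {0..1} \<phi>" "\<phi> 0 = 0"
    "\<And>t. t \<in> {0..1} \<Longrightarrow> k t = of_real (norm (k t)) * cis (\<phi> t)"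
proof -
  have "contractible {0..1::real}" by (intro convex_imp_contractible) simp
  then obtain l where l: "continuous_on {0..1} l" "\<And>t. t \<in> {0..1} \<Longrightarrow> k t = exp (l t)"
    using continuous_logarithm_on_contractible[OF assms(1) _ assms(2)] by metis
  have e: "exp (l t) = of_real (norm (exp (l t))) * cis (Im (l t))" for t
    using exp_eq_polar[of "l t"] norm_exp_eq_Re[of "l t"] by metis
  have "exp (l 0) = of_real v" using l(2)[of 0] v(1) by simp
  then have c0: "cis (Im (l 0)) = 1"
    using e[of 0] v(2) by simp
  have "k t = of_real (norm (k t)) * cis (Im (l t) - Im (l 0))" if "t \<in> {0..1}" for t
  proof -
    have "cis (Im (l t) - Im (l 0)) = cis (Im (l t))"
      using c0 by (simp flip: cis_divide)
    then show ?thesis unfolding l(2)[OF that] by (simp only: e [symmetric])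
  qed
  moreover have "continuous_on {0..1} (\<lambda>t. Im (l t) - Im (l 0))"
    by (intro continuous_intros l)
  ultimately show ?thesis by (intro that[of "\<lambda>t. Im (l t) - Im (l 0)"]) auto
qed

subsection \<open>Growth of S\<close>

lemma zeta_minus_one_bound:
  assumes "Re s = 2"
  shows "norm (zeta s - 1) \<le> pi\<^sup>2 / 6 - 1"
proof -
  have sq: "(\<lambda>n. 1 / (real (Suc n) + 1)\<^sup>2) sums (pi\<^sup>2 / 6 - 1)"
    using inverse_squares_sums by (subst sums_Suc_iff) (simp add: add_ac)
  have z: "(\<lambda>n. 1 / of_nat (Suc (Suc n)) powr s) sums (zeta s - 1)"
    using zeta_sums[of s] assms by (subst sums_Suc_iff) simp
  have "norm (\<Sum>n. 1 / of_nat (Suc (Suc n)) powr s) \<le> (\<Sum>n. 1 / (real (Suc n) + 1)\<^sup>2)"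
  proof (rule norm_suminf_le)
    show "norm (1 / of_nat (Suc (Suc n)) powr s) \<le> 1 / (real (Suc n) + 1)\<^sup>2" for n
      unfolding norm_dseries_term assms by (simp add: powr_minus powr_numeral divide_inverse add_ac)
  qed (use sq in \<open>simp add: sums_iff\<close>)
  then show ?thesis using sq z by (simp add: sums_iff)
qed

text \<open>Serves twice: zeta stays in the right half-plane on the vertical part of the path, and
  Jensen's inequality gets a lower bound at its centre.\<close>

lemma Re_zeta_ge:
  assumes "Re s = 2"
  shows "Re (zeta s) \<ge> 1 / 4"
proof -
  have "pi \<le> 63/20" using pi_approx(2) by simp
  then have "pi * pi \<le> 63/20 * (63/20)" by (intro mult_mono) auto
  then have "\<bar>Re (zeta s) - 1\<bar> \<le> 3/4"
    using zeta_minus_one_bound[OF assms] abs_Re_le_cmod[of "zeta s - 1"]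
    by (simp add: power2_eq_square)
  then show ?thesis by linarith
qed

lemma zeta_2: "zeta 2 = of_real (pi\<^sup>2 / 6)"
proof -
  have "(\<lambda>n. complex_of_real (1 / (real n + 1)\<^sup>2)) sums of_real (pi\<^sup>2 / 6)"
    using inverse_squares_sums by (intro sums_of_real) (simp add: add_ac)
  also have "(\<lambda>n. complex_of_real (1 / (real n + 1)\<^sup>2)) = (\<lambda>n. 1 / of_nat (Suc n) powr 2)"
    by (simp add: powr_numeral add_ac)
  finally show ?thesis using zeta_sums[of 2] sums_unique2 by (metis complex_Re_numeral one_less_numeral_iff semiring_norm(76))
qed

lemma entire_zeta_mult_bound:
  obtains Z C where "Z holomorphic_on UNIV" "\<And>s. s \<noteq> 1 \<Longrightarrow> Z s = (s - 1) * zeta s" "C > 0"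
    "\<And>s. Re s \<ge> 1/4 \<Longrightarrow> norm (Z s) \<le> C * (1 + norm s) ^ 2"
proof -
  obtain Z where Z: "Z holomorphic_on UNIV" "\<And>s. s \<noteq> 1 \<Longrightarrow> Z s = (s - 1) * zeta s"
    using entire_zeta_mult by metis
  obtain C where C: "C > 0" "\<And>s. Re s \<ge> 1/4 \<Longrightarrow> s \<noteq> 1 \<Longrightarrow> norm ((s - 1) * zeta s) \<le> C * (1 + norm s) ^ 2"
    using zeta_mult_bound by metis
  \<comment> \<open>\<open>C\<close> says nothing at the point 1, so the value of \<open>Z\<close>
    there is added to the constant.\<close>
  have "norm (Z s) \<le> (C + norm (Z 1)) * (1 + norm s) ^ 2" if "Re s \<ge> 1/4" for s
  proof (cases "s = 1")
    case True
    then show ?thesis using C(1) by simp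
  next
    case False
    then have "norm (Z s) \<le> C * (1 + norm s) ^ 2" using C(2)[OF that] Z(2) by simp
    also have "\<dots> \<le> (C + norm (Z 1)) * (1 + norm s) ^ 2" by (intro mult_right_mono) auto
    finally show ?thesis .
  qed
  moreover have "C + norm (Z 1) > 0" using C(1) by (simp add: add_pos_nonneg)
  ultimately show ?thesis using Z by (intro that[of Z "C + norm (Z 1)"]) auto
qed

lemma ln_le_const_sqrt:
  fixes C :: real
  assumes "C > 0"
  obtains D where "D > 0" "\<And>x. x \<ge> 1 \<Longrightarrow> ln (C * (5 + x)\<^sup>2) \<le> D * sqrt x"
proof -
  have "ln (C * (5 + x)\<^sup>2) \<le> (\<bar>ln C\<bar> + 2 * ln 6 + 4) * sqrt x" if x: "x \<ge> 1" for x
  proof -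
    have s1: "sqrt x \<ge> 1" using x by simp
    have "ln (sqrt x) \<le> sqrt x - 1" using s1 by (intro ln_le_minus_one) auto
    then have lnx: "ln x \<le> 2 * sqrt x" using x by (simp add: ln_sqrt)
    have "ln (5 + x) \<le> ln (6 * x)" using x by simp
    then have "ln (5 + x) \<le> ln 6 + 2 * sqrt x" using x lnx by (simp add: ln_mult)
    moreover have "ln (C * (5 + x)\<^sup>2) = ln C + 2 * ln (5 + x)"
      using assms x by (simp add: ln_mult ln_realpow)
    ultimately have "ln (C * (5 + x)\<^sup>2) \<le> (\<bar>ln C\<bar> + 2 * ln 6) * 1 + 4 * sqrt x" by simp
    also have "\<dots> \<le> (\<bar>ln C\<bar> + 2 * ln 6) * sqrt x + 4 * sqrt x"
      using s1 by (intro add_right_mono mult_left_mono) auto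
    finally show ?thesis by (simp add: algebra_simps)
  qed
  then show ?thesis by (intro that[of "\<bar>ln C\<bar> + 2 * ln 6 + 4"]) (auto intro!: add_nonneg_pos)
qed

text \<open>Working with \<open>Z s = (s - 1) * \<zeta>(s)\<close> removes the pole, which lies in the disc of radius
  \<open>7/4\<close> around \<open>2 + i T\<close> for small \<open>T\<close>.\<close>

lemma arg_horizontal_bound:
  fixes T :: real and Z :: "complex \<Rightarrow> complex"
  assumes Z: "Z holomorphic_on UNIV" "\<And>s. s \<noteq> 1 \<Longrightarrow> Z s = (s - 1) * zeta s"
    and C: "C > 0" "\<And>s. Re s \<ge> 1/4 \<Longrightarrow> norm (Z s) \<le> C * (1 + norm s) ^ 2"
    and T: "T \<ge> 1"
    and \<psi>: "continuous_on {0..1} \<psi>" "\<psi> 0 = 0"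
    and Z\<psi>: "\<And>t. t \<in> {0..1} \<Longrightarrow> u * Z (Complex (2 - 3/2 * t) T) =
           of_real (norm (Z (Complex (2 - 3/2 * t) T))) * cis (\<psi> t)"
    and u: "norm u = 1"
  shows "\<bar>\<psi> 1\<bar> \<le> pi * (1 + ln (4 * C * (5 + T)\<^sup>2) / ln (7/6))"
proof -
  define h where "h = (\<lambda>w. u * Z (w + \<i> * of_real T))"
  define v where "v = norm (Z (Complex 2 T))"
  define N where "N = nat \<lfloor>\<bar>\<psi> 1\<bar> / pi\<rfloor>"
  have h_real: "h (of_real x) = u * Z (Complex x T)" for x
    by (simp add: h_def Complex_eq)
  have nh: "norm (h w) = norm (Z (w + \<i> * of_real T))" for w
    using u by (simp add: h_def norm_mult)
  have "norm (zeta (Complex 2 T)) \<ge> 1/4"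
    using Re_zeta_ge[of "Complex 2 T"] abs_Re_le_cmod[of "zeta (Complex 2 T)"] by simp
  moreover have "norm (Complex 2 T - 1) \<ge> 1"
    using abs_Re_le_cmod[of "Complex 2 T - 1"] by simp
  ultimately have "1 * (1/4) \<le> norm (Complex 2 T - 1) * norm (zeta (Complex 2 T))"
    by (intro mult_mono) auto
  moreover have "Complex 2 T \<noteq> 1" by (simp add: complex_eq_iff)
  ultimately have v: "v \<ge> 1/4" unfolding v_def by (simp add: Z(2) norm_mult)
  \<comment> \<open>3/2 is the length of the segment from \<open>2 + i T\<close> to
    \<open>1/2 + i T\<close>; 7/4 exceeds it while keeping the disc inside
    \<open>Re s \<ge> 1/4\<close>. In this disc \<open>norm w \<le> 15/4\<close>, whence the bound
    with \<open>5 + T\<close>.\<close>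
  have "v \<le> (C * (5 + T)\<^sup>2) * ((3/2) / (7/4)) ^ N"
  proof (rule real_axis_arg_variation[where h = h and x = 2 and \<phi> = \<psi>])
    have "Z \<circ> (\<lambda>w. w + \<i> * of_real T) holomorphic_on ball (of_real 2) (7/4)"
      by (rule holomorphic_on_compose_gen[OF _ Z(1)]) (auto intro!: holomorphic_intros)
    then show "h holomorphic_on ball (of_real 2) (7/4)"
      unfolding h_def o_def by (intro holomorphic_intros)
    show "norm (h w) \<le> C * (5 + T)\<^sup>2" if "w \<in> ball (of_real 2) (7/4)" for w
    proof -
      have d: "norm (2 - w) < 7/4" using that by (simp add: dist_norm)
      have "Re w \<ge> 1/4" using d abs_Re_le_cmod[of "2 - w"] by (simp add: abs_if split: if_splits)
      then have "norm (h w) \<le> C * (1 + norm (w + \<i> * of_real T))\<^sup>2"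
        unfolding nh by (intro C(2)) simp
      moreover have "norm w \<le> 15/4" using d norm_triangle_ineq2[of w 2] by (simp add: norm_minus_commute)
      moreover have "norm (w + \<i> * of_real T) \<le> norm w + T"
        using norm_triangle_ineq[of w "\<i> * of_real T"] T by (simp add: norm_mult)
      ultimately show ?thesis
        using C(1) by (elim order_trans) (intro mult_left_mono power_mono, auto)
    qed
    have "h (of_real 2) = of_real v"
      unfolding h_real v_def using Z\<psi>[of 0] \<psi>(2) by simp
    then show "h (of_real 2) = of_real v" .
    show "h (of_real (2 - 3/2 * t)) = of_real (norm (h (of_real (2 - 3/2 * t)))) * cis (\<psi> t)"
      if "t \<in> {0..1}" for t
      unfolding h_real norm_mult u mult_1_left by (rule Z\<psi>[OF that])
    show "real N * pi \<le> \<bar>\<psi> 1\<bar>"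
    proof -
      have "real N \<le> \<bar>\<psi> 1\<bar> / pi" unfolding N_def by (simp add: of_nat_nat)
      then show ?thesis by (simp add: field_simps)
    qed
  qed (use \<psi> v in auto)
  then have "1/4 \<le> (C * (5 + T)\<^sup>2) * (6/7) ^ N" using v by simp
  then have "(7/6) ^ N \<le> 4 * C * (5 + T)\<^sup>2"
    by (simp add: power_divide field_simps)
  then have "ln ((7/6) ^ N) \<le> ln (4 * C * (5 + T)\<^sup>2)" by (rule ln_mono) auto
  then have "real N * ln (7/6) \<le> ln (4 * C * (5 + T)\<^sup>2)" by (simp add: ln_realpow)
  then have "real N \<le> ln (4 * C * (5 + T)\<^sup>2) / ln (7/6)" by (simp add: pos_le_divide_eq)
  moreover have "\<bar>\<psi> 1\<bar> / pi \<le> 1 + real N" unfolding N_def by linarith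
  ultimately have "\<bar>\<psi> 1\<bar> / pi \<le> 1 + ln (4 * C * (5 + T)\<^sup>2) / ln (7/6)" by linarith
  then show ?thesis by (simp add: field_simps)
qed

text \<open>On the vertical half of the path \<open>Re (zeta s)\<close> never vanishes, so the
  argument stays within \<open>pi / 2\<close>. On the horizontal half it differs from the argument
  of \<open>(s - 1) * zeta s\<close> by the principal argument of \<open>s - 1\<close>, which is
  bounded.\<close>

lemma S_regular_bound:
  obtains K where "K > 0"
    "\<And>T. T \<ge> 1 \<Longrightarrow> \<not> is_ordinate T \<Longrightarrow> \<bar>S_regular T\<bar> \<le> K * sqrt T"
proof -
  obtain Z C where Z: "Z holomorphic_on UNIV" "\<And>s. s \<noteq> 1 \<Longrightarrow> Z s = (s - 1) * zeta s"
    and C: "C > 0" "\<And>s. Re s \<ge> 1/4 \<Longrightarrow> norm (Z s) \<le> C * (1 + norm s) ^ 2"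
    using entire_zeta_mult_bound by metis
  obtain D where D: "D > 0" "\<And>x. x \<ge> 1 \<Longrightarrow> ln (4 * C * (5 + x)\<^sup>2) \<le> D * sqrt x"
    using ln_le_const_sqrt[of "4 * C"] C(1) by (metis mult_pos_pos zero_less_numeral)
  have l76: "ln (7/6 :: real) > 0" by simp
  have main: "\<bar>S_regular T\<bar> \<le> (4 + D / ln (7/6)) * sqrt T" if T: "T \<ge> 1" "\<not> is_ordinate T" for T
  proof -
    define P where "P = linepath 2 (Complex 2 T) +++ linepath (Complex 2 T) (Complex (1/2) T)"
    have P1: "P t = Complex 2 (2 * t * T)" if "t \<le> 1/2" for t
      using that by (simp add: P_def joinpaths_def linepath_def complex_eq_iff algebra_simps)
    have P2: "P ((1 + t) / 2) = Complex (2 - 3/2 * t) T" if "t \<ge> 0" for t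
    proof (cases "t = 0")
      case True
      then show ?thesis using P1[of "1/2"] by simp
    next
      case False
      then show ?thesis using that
        by (simp add: P_def joinpaths_def linepath_def complex_eq_iff field_simps)
    qed
    have P_cases: "Re (P t) = 2 \<or> Im (P t) = T" for t
    proof (cases "t \<le> 1/2")
      case True
      then show ?thesis by (simp add: P1)
    next
      case False
      then have "P t = P ((1 + (2 * t - 1)) / 2)" by simp
      also have "\<dots> = Complex (2 - 3/2 * (2 * t - 1)) T" using False by (intro P2) simp
      finally show ?thesis by simp
    qed
    have P_ne: "P t \<noteq> 1" for t using P_cases[of t] T by auto
    have nz: "zeta (P t) \<noteq> 0" for t
      using P_cases[of t] Re_zeta_ge[of "P t"] T(2) by (auto simp: is_ordinate_def)
    have "path P" unfolding P_def by (intro path_join_imp) auto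
    then have cont: "continuous_on {0..1} (\<lambda>t. zeta (P t))"
      using P_ne unfolding path_def
      by (intro continuous_on_compose2[OF holomorphic_on_imp_continuous_on[OF holomorphic_on_zeta]]) auto
    have "P 0 = 2" using P1[of 0] by (simp add: complex_eq_iff)
    then have z0: "zeta (P 0) = of_real (pi\<^sup>2 / 6)" by (simp add: zeta_2)
    obtain \<phi> where \<phi>: "continuous_on {0..1} \<phi>" "\<phi> 0 = 0"
      "\<And>t. t \<in> {0..1} \<Longrightarrow> zeta (P t) = of_real (norm (zeta (P t))) * cis (\<phi> t)"
      using continuous_argument_exists[OF cont nz z0] by auto
    have "arg_along zeta P = \<phi> 1"
      by (rule arg_along_eqI[where g = zeta and p = P]) (fact \<phi>, fact \<phi>, fact \<phi>, rule nz)
    then have S_eq: "S_regular T = 1 / pi * \<phi> 1"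
      unfolding S_regular_def P_def by (simp only:)
    have half: "\<bar>\<phi> (1/2)\<bar> \<le> pi / 2"
    proof (rule ccontr)
      assume "\<not> ?thesis"
      moreover have "continuous_on {0..1/2} (\<lambda>t. \<bar>\<phi> t\<bar>)"
        by (intro continuous_intros continuous_on_subset[OF \<phi>(1)]) auto
      ultimately obtain t where t: "0 \<le> t" "t \<le> 1/2" "\<bar>\<phi> t\<bar> = pi / 2"
        using IVT'[of "\<lambda>t. \<bar>\<phi> t\<bar>" 0 "pi / 2" "1/2"] \<phi>(2) by auto
      have "cos (\<phi> t) = cos \<bar>\<phi> t\<bar>" by simp
      then have "cos (\<phi> t) = 0" unfolding t(3) by simp
      moreover have "Re (of_real r * cis y) = r * cos y" for r y by simp
      moreover have "t \<in> {0..1}" using t by simp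
      ultimately have "Re (zeta (P t)) = 0"
        using arg_cong[OF \<phi>(3), of t Re] by (metis mult_zero_right)
      then show False using Re_zeta_ge[of "P t"] P1[OF t(2)] by simp
    qed
    \<comment> \<open>\<open>\<psi>\<close> is the argument of \<open>Z\<close> on the horizontal
      half, renormalised to start at 0, and \<open>u\<close> is the matching rotation. The principal
      argument of \<open>s - 1\<close> is continuous there because its imaginary part
      \<open>T\<close> is positive.\<close>
    define \<psi> where "\<psi> = (\<lambda>t. \<phi> ((1 + t) / 2) - \<phi> (1/2)
        + Arg (Complex (1 - 3/2 * t) T) - Arg (Complex 1 T))"
    define u where "u = cis (- \<phi> (1/2) - Arg (Complex 1 T))"
    have "\<bar>\<psi> 1\<bar> \<le> pi * (1 + ln (4 * C * (5 + T)\<^sup>2) / ln (7/6))"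
    proof (rule arg_horizontal_bound[OF Z C T(1)])
      have "continuous_on {0..1} (\<lambda>t. \<phi> ((1 + t) / 2))"
        by (rule continuous_on_compose2[OF \<phi>(1)]) (auto intro!: continuous_intros)
      moreover have "continuous_on {0..1} (\<lambda>t. Arg (Complex (1 - 3/2 * t) T))"
      proof (rule continuous_on_Arg')
        show "continuous_on {0..1} (\<lambda>t. Complex (1 - 3/2 * t) T)"
          unfolding Complex_eq by (intro continuous_intros)
        show "Complex (1 - 3/2 * t) T \<notin> \<real>\<^sub>\<le>\<^sub>0" for t
          using T(1) by (simp add: complex_nonpos_Reals_iff)
      qed
      ultimately show "continuous_on {0..1} \<psi>" 
        unfolding \<psi>_def by (intro continuous_on_add continuous_on_diff continuous_on_const)
      show "\<psi> 0 = 0" by (simp add: \<psi>_def)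
      show "norm u = 1" by (simp add: u_def)
      fix t :: real assume t: "t \<in> {0..1}"
      define s where "s = Complex (2 - 3/2 * t) T"
      have s1: "s - 1 = Complex (1 - 3/2 * t) T" by (simp add: s_def complex_eq_iff)
      have "s \<noteq> 1" using T(1) by (auto simp: s_def complex_eq_iff)
      have zs: "zeta s = of_real (norm (zeta s)) * cis (\<phi> ((1 + t) / 2))"
        using \<phi>(3)[of "(1 + t) / 2"] t P2[of t] by (simp add: s_def)
      have as: "s - 1 = of_real (norm (s - 1)) * cis (Arg (Complex (1 - 3/2 * t) T))"
        using rcis_cmod_Arg[of "s - 1"] unfolding s1 by (simp add: rcis_def)
      have "u * Z s = u * ((of_real (norm (s - 1)) * cis (Arg (Complex (1 - 3/2 * t) T))) *
              (of_real (norm (zeta s)) * cis (\<phi> ((1 + t) / 2))))"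
        unfolding Z(2)[OF \<open>s \<noteq> 1\<close>] by (simp only: as [symmetric] zs [symmetric])
      also have "\<dots> = of_real (norm (s - 1) * norm (zeta s)) *
          (cis (- \<phi> (1/2) - Arg (Complex 1 T)) * cis (Arg (Complex (1 - 3/2 * t) T)) * cis (\<phi> ((1 + t) / 2)))"
        unfolding u_def of_real_mult by (simp only: mult_ac)
      also have "norm (s - 1) * norm (zeta s) = norm (Z s)"
        unfolding Z(2)[OF \<open>s \<noteq> 1\<close>] norm_mult ..
      also have "cis (- \<phi> (1/2) - Arg (Complex 1 T)) * cis (Arg (Complex (1 - 3/2 * t) T)) * cis (\<phi> ((1 + t) / 2)) = cis (\<psi> t)"
        unfolding cis_mult \<psi>_def by (rule arg_cong[of _ _ cis]) simp
      finally show "u * Z (Complex (2 - 3/2 * t) T) =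
           of_real (norm (Z (Complex (2 - 3/2 * t) T))) * cis (\<psi> t)"
        unfolding s_def .
    qed
    moreover have "\<bar>Arg z\<bar> \<le> pi" for z using Arg_bounded[of z] by (auto simp: abs_le_iff)
    from this[of "Complex (1 - 3/2 * 1) T"] this[of "Complex 1 T"]
    have "\<bar>\<phi> 1\<bar> \<le> \<bar>\<psi> 1\<bar> + pi / 2 + pi + pi" using half unfolding \<psi>_def by simp
    \<comment> \<open>The sum \<open>pi / 2 + pi + pi\<close> is rounded up to
      \<open>3 * pi\<close>, which produces the 4 in the final constant.\<close>
    ultimately have "\<bar>\<phi> 1\<bar> \<le> pi * (1 + ln (4 * C * (5 + T)\<^sup>2) / ln (7/6)) + 3 * pi"
      using pi_gt_zero by linarith
    then have "\<bar>\<phi> 1\<bar> / pi \<le> 4 + ln (4 * C * (5 + T)\<^sup>2) / ln (7/6)"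
      by (simp add: field_simps)
    also have "\<dots> \<le> 4 * sqrt T + D * sqrt T / ln (7/6)"
      using D(2)[OF T(1)] T(1) l76 by (intro add_mono divide_right_mono) auto
    finally show ?thesis unfolding S_eq by (simp add: abs_mult algebra_simps)
  qed
  show ?thesis by (rule that[OF _ main]) (use D l76 in \<open>auto intro!: add_pos_nonneg\<close>)
qed

lemma countable_ordinates: "countable {T. is_ordinate T}"
proof -
  have "countable {s \<in> - {1}. zeta s = 0}"
  proof (rule holomorphic_countable_zeros[OF holomorphic_on_zeta])
    show "connected (- {1 :: complex})" by (intro connected_punctured_universe) simp
    have "- {1 :: complex} = (\<Union>n. - ball 1 (inverse (real (Suc n))))"
    proof (rule set_eqI)
      fix z :: complex
      have "z \<noteq> 1 \<longleftrightarrow> 0 < dist 1 z" by auto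
      also have "\<dots> \<longleftrightarrow> (\<exists>n. inverse (real (Suc n)) \<le> dist 1 z)"
        by (metis reals_Archimedean less_imp_le inverse_positive_iff_positive of_nat_0_less_iff
            zero_less_Suc less_le_trans)
      finally show "z \<in> - {1} \<longleftrightarrow> z \<in> (\<Union>n. - ball 1 (inverse (real (Suc n))))"
        by (simp add: not_less)
    qed
    moreover have "fsigma (\<Union>n. - ball (1 :: complex) (inverse (real (Suc n))))"
      by (rule fsigma.intros) (intro closed_Compl open_ball)
    ultimately show "fsigma (- {1 :: complex})" by simp
    show "\<not> zeta constant_on - {1}"
    proof
      assume "zeta constant_on - {1}"
      then obtain k where k: "\<And>s. s \<noteq> 1 \<Longrightarrow> zeta s = k" by (auto simp: constant_on_def)
      \<comment> \<open>The terms of \<open>zeta 2 - zeta 3\<close> are nonnegative and not all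
        zero, so the two values differ.\<close>
      define g where "g = (\<lambda>n. 1 / real (Suc n) ^ 2 - 1 / real (Suc n) ^ 3)"
      have "(\<lambda>n. 1 / of_nat (Suc n) powr 2 - 1 / of_nat (Suc n) powr 3) sums (zeta 2 - zeta 3)"
        by (intro sums_diff zeta_sums) auto
      also have "zeta 2 - zeta 3 = of_real 0" using k[of 2] k[of 3] by simp
      also have "(\<lambda>n. 1 / of_nat (Suc n) powr 2 - 1 / of_nat (Suc n) powr 3) = (\<lambda>n. complex_of_real (g n))"
        by (simp add: g_def powr_numeral)
      finally have "g sums 0" unfolding sums_of_real_iff .
      moreover have "g n \<ge> 0" for n
        using power_increasing[of 2 3 "real (Suc n)"] by (simp add: g_def frac_le)
      ultimately have "g 1 = 0" using suminf_eq_zero_iff[of g] by (auto simp: sums_iff)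
      then show False by (simp add: g_def)
    qed
  qed auto
  \<comment> \<open>The value \<open>zeta 1\<close> is unspecified and may be 0, which would make 0
    an ordinate; hence the inserted point.\<close>
  then have "countable (Im ` insert 1 {s \<in> - {1}. zeta s = 0})" by blast
  moreover have "{T. is_ordinate T} \<subseteq> Im ` insert 1 {s \<in> - {1}. zeta s = 0}"
    by (auto simp: is_ordinate_def)
  ultimately show ?thesis by (rule countable_subset[rotated])
qed

subsection \<open>Growth of f\<close>

text \<open>For \<open>a > 0\<close> the numbers \<open>z\<close> and \<open>z / k + 1\<close> lie
  in the right half-plane, where the principal argument is an arctangent; the term
  \<open>k = 0\<close> stems from \<open>ln z\<close> itself.\<close>

lemma Im_ln_Gamma_series:
  assumes a: "a > 0" and n: "n > 0"
  shows "Im (ln_Gamma_series (Complex a t) n) = t * ln (real n) - (\<Sum>k\<le>n. arctan (t / (real k + a)))"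
proof -
  have "Im (ln (Complex a t / of_nat k + 1)) = arctan (t / (real k + a))" if "k \<in> {1..n}" for k
  proof -
    have k: "real k > 0" using that by simp
    have e: "Complex a t / of_nat k + 1 = Complex (a / real k + 1) (t / real k)"
      using k by (simp add: complex_eq_iff Re_divide_of_nat Im_divide_of_nat)
    have "a / real k + 1 > 0" using a k by (simp add: add_pos_pos)
    then have "Complex a t / of_nat k + 1 \<noteq> 0" unfolding e complex_eq_iff by simp
    then have "Im (ln (Complex a t / of_nat k + 1)) = Arg (Complex a t / of_nat k + 1)" by (simp add: Arg_eq_Im_Ln)
    also have "\<dots> = arctan ((t / real k) / (a / real k + 1))"
      unfolding e using a k by (subst arg_conv_arctan) (auto simp: add_pos_pos)
    also have "(t / real k) / (a / real k + 1) = t / (real k + a)"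
      using a k by (simp add: field_simps)
    finally show ?thesis .
  qed
  then have "(\<Sum>k=1..n. Im (ln (Complex a t / of_nat k + 1))) = (\<Sum>k=1..n. arctan (t / (real k + a)))"
    by (intro sum.cong) auto
  moreover have "Complex a t \<noteq> 0" using a by (auto simp: complex_eq_iff)
  then have "Im (ln (Complex a t)) = arctan (t / (real 0 + a))"
    using a by (simp add: Arg_eq_Im_Ln [symmetric] arg_conv_arctan)
  moreover have "(\<Sum>k\<le>n. arctan (t / (real k + a))) = arctan (t / (real 0 + a)) + (\<Sum>k=1..n. arctan (t / (real k + a)))"
    by (simp only: atMost_atLeast0 sum.atLeast_Suc_atMost[OF le0] One_nat_def)
  moreover have "Im (Complex a t * ln (of_nat n)) = t * ln (real n)"
    using n by simp
  ultimately show ?thesis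
    unfolding ln_Gamma_series_def by (simp only: minus_complex.sel Im_sum)
qed

definition arctan_primitive :: "real \<Rightarrow> real \<Rightarrow> real" where
  "arctan_primitive t x = x * arctan (t / x) + t / 2 * ln (x\<^sup>2 + t\<^sup>2)"

lemma arctan_primitive_deriv:
  assumes "x > 0"
  shows "(arctan_primitive t has_real_derivative arctan (t / x)) (at x)"
proof -
  have p: "x\<^sup>2 + t\<^sup>2 > 0" using assms by (simp add: sum_power2_gt_zero_iff)
  have i: "inverse (1 + (t / x)\<^sup>2) = x\<^sup>2 / (x\<^sup>2 + t\<^sup>2)"
    using assms p by (simp add: field_simps)
  have "(arctan_primitive t has_real_derivative
     (arctan (t / x) + x * (x\<^sup>2 / (x\<^sup>2 + t\<^sup>2) * (- t / x\<^sup>2)) + t / 2 * (2 * x / (x\<^sup>2 + t\<^sup>2)))) (at x)"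
    unfolding arctan_primitive_def using assms p i
    by (auto intro!: derivative_eq_intros simp: power2_eq_square divide_simps)
  moreover have "x * (x\<^sup>2 / (x\<^sup>2 + t\<^sup>2) * (- t / x\<^sup>2)) + t / 2 * (2 * x / (x\<^sup>2 + t\<^sup>2)) = 0"
    using assms p by (simp add: field_simps power2_eq_square)
  ultimately show ?thesis by (simp only: add.assoc add_0_right)
qed

text \<open>For \<open>t > 0\<close> the function \<open>arctan (t / x)\<close> decreases in
  \<open>x\<close>, so its mean over a unit interval lies between its end values.\<close>

lemma arctan_primitive_step:
  assumes "x > 0" "t > 0"
  shows "arctan_primitive t (x + 1) - arctan_primitive t x \<le> arctan (t / x)"
    and "arctan (t / (x + 1)) \<le> arctan_primitive t (x + 1) - arctan_primitive t x"
proof -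
  obtain z where z: "x < z" "z < x + 1"
    "arctan_primitive t (x + 1) - arctan_primitive t x = (x + 1 - x) * arctan (t / z)"
    using MVT2[of x "x + 1" "arctan_primitive t" "\<lambda>z. arctan (t / z)"] arctan_primitive_deriv assms(1)
    by fastforce
  then show "arctan_primitive t (x + 1) - arctan_primitive t x \<le> arctan (t / x)"
    and "arctan (t / (x + 1)) \<le> arctan_primitive t (x + 1) - arctan_primitive t x"
    using assms by (auto simp: arctan_le_iff intro!: divide_left_mono)
qed

lemma arctan_sum_bounds:
  assumes a: "a > 0" and t: "t > 0"
  shows "arctan_primitive t (real n + a) - arctan_primitive t a \<le> (\<Sum>k\<le>n. arctan (t / (real k + a)))"
    and "(\<Sum>k\<le>n. arctan (t / (real k + a))) \<le> pi / 2 + arctan_primitive t (real n + a) - arctan_primitive t a"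
proof -
  have "arctan_primitive t (real n + a) - arctan_primitive t a \<le> (\<Sum>k<n. arctan (t / (real k + a)))"
  proof (induction n)
    case (Suc n)
    then show ?case using arctan_primitive_step(1)[of "real n + a" t] a t by (simp add: add_ac)
  qed simp
  also have "\<dots> \<le> (\<Sum>k\<le>n. arctan (t / (real k + a)))"
    using a t by (simp add: lessThan_Suc_atMost[symmetric])
  finally show "arctan_primitive t (real n + a) - arctan_primitive t a \<le> (\<Sum>k\<le>n. arctan (t / (real k + a)))" .
  show "(\<Sum>k\<le>n. arctan (t / (real k + a))) \<le> pi / 2 + arctan_primitive t (real n + a) - arctan_primitive t a"
  proof (induction n)
    case 0
    then show ?case using arctan_ubound[of "t / a"] by simp
  next
    case (Suc n)
    then show ?case using arctan_primitive_step(2)[of "real n + a" t] a t by (simp add: add_ac)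
  qed
qed

lemma Im_ln_Gamma_bounds:
  assumes a: "a > 0" and t: "t > 0"
  shows "Im (ln_Gamma (Complex a t)) \<le> arctan_primitive t a - t"
    and "arctan_primitive t a - t - pi / 2 \<le> Im (ln_Gamma (Complex a t))"
proof -
  have "Complex a t \<notin> \<int>\<^sub>\<le>\<^sub>0" using t by (auto elim!: nonpos_Ints_cases simp: complex_eq_iff)
  then have lim: "(\<lambda>n. Im (ln_Gamma_series (Complex a t) n)) \<longlonglongrightarrow> Im (ln_Gamma (Complex a t))"
    by (intro tendsto_Im ln_Gamma_complex_LIMSEQ)
  \<comment> \<open>\<open>x * arctan (t / x)\<close> tends to \<open>t\<close> and the logarithms
    cancel in the limit; this is the \<open>- t\<close> of Stirling's formula.\<close>
  have P: "(\<lambda>n. t * ln (real n) - arctan_primitive t (real n + a)) \<longlonglongrightarrow> - t"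
    using a t unfolding arctan_primitive_def by real_asymp
  have lim1: "(\<lambda>n. t * ln (real n) - arctan_primitive t (real n + a) + arctan_primitive t a) \<longlonglongrightarrow> - t + arctan_primitive t a"
    and lim2: "(\<lambda>n. t * ln (real n) - arctan_primitive t (real n + a) + (arctan_primitive t a - pi / 2)) \<longlonglongrightarrow> - t + (arctan_primitive t a - pi / 2)"
    by (intro tendsto_add P tendsto_const)+
  have "eventually (\<lambda>n. Im (ln_Gamma_series (Complex a t) n) \<le>
     t * ln (real n) - arctan_primitive t (real n + a) + arctan_primitive t a) sequentially"
    using eventually_gt_at_top[of 0]
  proof eventually_elim
    case (elim n)
    then show ?case using arctan_sum_bounds(1)[OF a t, of n] Im_ln_Gamma_series[OF a elim, of t] by simp
  qed
  from tendsto_le[OF sequentially_bot lim1 lim this]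
  show "Im (ln_Gamma (Complex a t)) \<le> arctan_primitive t a - t" by simp
  have "eventually (\<lambda>n. t * ln (real n) - arctan_primitive t (real n + a) + (arctan_primitive t a - pi / 2)
     \<le> Im (ln_Gamma_series (Complex a t) n)) sequentially"
    using eventually_gt_at_top[of 0]
  proof eventually_elim
    case (elim n)
    then show ?case using arctan_sum_bounds(2)[OF a t, of n] Im_ln_Gamma_series[OF a elim, of t] by simp
  qed
  from tendsto_le[OF sequentially_bot lim lim2 this]
  show "arctan_primitive t a - t - pi / 2 \<le> Im (ln_Gamma (Complex a t))" by simp
qed

text \<open>With \<open>t = T / 2\<close> the elementary terms cancel
  \<open>t * ln t - t - t * ln pi\<close> in theta exactly. What remains of the argument of Gamma
  lies between \<open>- pi / 2\<close> and \<open>pi / 8 + 1/16\<close>.\<close>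

lemma f_bound:
  assumes T: "T \<ge> 1"
  shows "\<bar>f T\<bar> \<le> 2"
proof -
  define t where "t = T / 2"
  have t: "t \<ge> 1/2" using T by (simp add: t_def)
  define g where "g = Im (ln_Gamma (Complex (1/4) t))"
  have ln: "ln ((1/4)\<^sup>2 + t\<^sup>2) = 2 * ln t + ln (1 + 1 / (16 * t\<^sup>2))"
  proof -
    have "(1/4)\<^sup>2 + t\<^sup>2 = t\<^sup>2 * (1 + 1 / (16 * t\<^sup>2))" using t by (simp add: field_simps)
    then show ?thesis using t by (simp add: ln_mult_pos ln_realpow add_pos_pos)
  qed
  have lo: "0 \<le> t / 2 * ln (1 + 1 / (16 * t\<^sup>2))" using t by simp
  have "t / 2 * ln (1 + 1 / (16 * t\<^sup>2)) \<le> t / 2 * (1 / (16 * t\<^sup>2))"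
    using t by (intro mult_left_mono ln_add_one_self_le_self) auto
  also have "\<dots> \<le> 1 / 16" using t by (simp add: field_simps power2_eq_square)
  finally have hi: "t / 2 * ln (1 + 1 / (16 * t\<^sup>2)) \<le> 1 / 16" .
  have ar: "0 \<le> 1/4 * arctan (t / (1/4))" "1/4 * arctan (t / (1/4)) \<le> pi / 8"
    using t arctan_ubound[of "t / (1/4)"] by auto
  have P: "arctan_primitive t (1/4) = 1/4 * arctan (t / (1/4)) + (t * ln t + t / 2 * ln (1 + 1 / (16 * t\<^sup>2)))"
    unfolding arctan_primitive_def ln by (simp add: algebra_simps)
  have g: "g \<le> t * ln t - t + pi / 8 + 1/16" "t * ln t - t - pi / 2 \<le> g"
    using Im_ln_Gamma_bounds[of "1/4" t] t lo hi ar unfolding P g_def by linarith+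
  have l: "ln (T / (2 * pi)) = ln t - ln pi" using t by (simp add: t_def ln_div ln_mult)
  have "f T = (g - (t * ln t - t)) / pi + 1/8"
    unfolding f_def theta_def l t_def [symmetric] g_def [symmetric]
    using pi_gt_zero by (simp add: t_def field_simps)
  moreover have "\<bar>(g - (t * ln t - t)) / pi\<bar> \<le> 1"
    using g pi_gt3 by (simp add: abs_le_iff field_simps)
  ultimately show ?thesis by linarith
qed

subsection \<open>The integral of F\<close>

lemma integrable_powr_tail:
  fixes e :: real
  assumes "e < -1"
  shows "integrable lborel (\<lambda>x. indicator {1..} x * x powr e)"
proof -
  have "((\<lambda>x. x powr e) has_integral -(1 powr (e+1)) / (e+1)) {1..}"
    using assms by (intro has_integral_powr_to_inf) auto
  then have "(\<lambda>x. x powr e) absolutely_integrable_on {1..}"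
    by (intro nonnegative_absolutely_integrable_1) (auto simp: integrable_on_def)
  then have "set_integrable lborel {1..} (\<lambda>x. x powr e)"
    unfolding absolutely_integrable_on_def set_integrable_def
    by (subst integrable_completion [symmetric]) auto
  then show ?thesis by (simp add: set_integrable_def)
qed

text \<open>Sum and integral may be exchanged because the moduli of the terms add up to
  \<open>\<bar>g x\<bar> * x powr (norm z - Re s - 1)\<close>. The bound on \<open>g\<close> turns
  this into the majorant \<open>D\<close>, whose exponent is below -1 precisely when
  \<open>norm z < Re s - 1/2\<close>.\<close>

lemma mellin_tail_sums:
  fixes g :: "real \<Rightarrow> real" and s z :: complex
  assumes meas: "set_borel_measurable lborel {1..} g"
    and bd: "AE x in lborel. x \<ge> 1 \<longrightarrow> \<bar>g x\<bar> \<le> K * sqrt x"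
    and z: "norm z < Re s - 1/2"
  shows "(\<lambda>j. (-1) ^ j / fact j * (LINT x:{1..}|lborel. of_real (g x * ln x ^ j) * of_real x powr (- s - 1)) * z ^ j)
    sums (LINT x:{1..}|lborel. of_real (g x) * of_real x powr (- (s + z) - 1))"
proof -
  define q where "q = (\<lambda>j x. indicator {1..} x *\<^sub>R
     ((-z) ^ j / fact j * (of_real (g x * ln x ^ j) * of_real x powr (- s - 1))) :: complex)"
  define D where "D = (\<lambda>x. \<bar>K\<bar> * (indicator {1..} x * x powr (norm z - Re s - 1/2)) :: real)"
  have D: "integrable lborel D"
    unfolding D_def using z by (intro integrable_mult_right integrable_powr_tail) simp
  \<comment> \<open>Measurability is known for \<open>g\<close> cut off at 1, so the indicator is
    duplicated and each factor carries one copy.\<close>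
  have meas_q: "q j \<in> borel_measurable lborel" for j
  proof -
    have mult: "(\<lambda>x. of_real (a x) * b x) \<in> borel_measurable lborel"
      if "a \<in> borel_measurable lborel" "b \<in> borel_measurable borel"
      for a :: "real \<Rightarrow> real" and b :: "real \<Rightarrow> complex"
      using that by measurable
    have "(\<lambda>x. indicator {1..} x *\<^sub>R ((-z) ^ j / fact j * (of_real (ln x ^ j) * of_real x powr (- s - 1))) :: complex)
       \<in> borel_measurable borel"
      by (intro borel_measurable_continuous_on_indicator continuous_intros) auto
    from mult[OF meas[unfolded set_borel_measurable_def] this]
    have "(\<lambda>x. of_real (indicator {1..} x *\<^sub>R g x) * (indicator {1..} x *\<^sub>R
         ((-z) ^ j / fact j * (of_real (ln x ^ j) * of_real x powr (- s - 1))))) \<in> borel_measurable lborel" .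
    also have "(\<lambda>x. of_real (indicator {1..} x *\<^sub>R g x) * (indicator {1..} x *\<^sub>R
         ((-z) ^ j / fact j * (of_real (ln x ^ j) * of_real x powr (- s - 1))))) = q j"
      by (auto simp: q_def fun_eq_iff split: split_indicator)
    finally show ?thesis .
  qed
  have norm_q: "norm (q j x) = indicator {1..} x * \<bar>g x\<bar> * x powr (- Re s - 1) * ((norm z * ln x) ^ j / fact j)" for j x
    by (auto simp: q_def norm_mult norm_divide norm_power norm_powr_real_powr power_mult_distrib abs_mult
        split: split_indicator)
  have norm_sums: "(\<lambda>j. norm (q j x)) sums (indicator {1..} x * \<bar>g x\<bar> * x powr (norm z - Re s - 1))" for x
  proof (cases "x \<ge> 1")
    case True
    have "(\<lambda>j. indicator {1..} x * \<bar>g x\<bar> * x powr (- Re s - 1) * ((norm z * ln x) ^ j / fact j)) sums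
       (indicator {1..} x * \<bar>g x\<bar> * x powr (- Re s - 1) * exp (norm z * ln x))"
      using exp_converges[of "norm z * ln x"] by (intro sums_mult) (simp add: divide_inverse mult.commute)
    also have "indicator {1..} x * \<bar>g x\<bar> * x powr (- Re s - 1) * exp (norm z * ln x) =
       indicator {1..} x * \<bar>g x\<bar> * x powr (norm z - Re s - 1)"
      using True by (simp add: powr_def algebra_simps flip: exp_add)
    finally show ?thesis unfolding norm_q .
  next
    case False
    then show ?thesis by (simp add: q_def)
  qed
  have q_sums: "(\<lambda>j. q j x) sums (indicator {1..} x *\<^sub>R (of_real (g x) * of_real x powr (- (s + z) - 1)))" for x
  proof (cases "x \<ge> 1")
    case True
    have "(\<lambda>j. of_real (g x) * of_real x powr (- s - 1) * ((- z * of_real (ln x)) ^ j / fact j)) sums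
       (of_real (g x) * of_real x powr (- s - 1) * exp (- z * of_real (ln x)))"
      using exp_converges[of "- z * of_real (ln x)"]
      by (intro sums_mult) (simp add: scaleR_conv_of_real divide_inverse mult.commute)
    also have "of_real (g x) * of_real x powr (- s - 1) * exp (- z * of_real (ln x)) =
       of_real (g x) * of_real x powr (- (s + z) - 1)"
      using True by (simp add: powr_def Ln_of_real algebra_simps flip: exp_add)
    also have "(\<lambda>j. of_real (g x) * of_real x powr (- s - 1) * ((- z * of_real (ln x)) ^ j / fact j)) = (\<lambda>j. q j x)"
      using True unfolding q_def power_mult_distrib by (simp add: mult_ac)
    finally show ?thesis using True by simp
  next
    case False
    then show ?thesis by (simp add: q_def)
  qed
  have sum_le_D: "AE x in lborel. (\<Sum>j<n. norm (q j x)) \<le> D x" for n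
    using bd
  proof eventually_elim
    case (elim x)
    have "(\<Sum>j<n. norm (q j x)) \<le> indicator {1..} x * \<bar>g x\<bar> * x powr (norm z - Re s - 1)"
      using sum_le_suminf[OF sums_summable[OF norm_sums[of x]], of "{..<n}"] sums_unique[OF norm_sums[of x]]
      by simp
    also have "\<dots> \<le> D x"
    proof (cases "x \<ge> 1")
      case True
      then have "\<bar>g x\<bar> \<le> K * sqrt x" using elim by blast
      also have "\<dots> \<le> \<bar>K\<bar> * x powr (1/2)" using True by (simp add: powr_half_sqrt mult_right_mono)
      finally have "\<bar>g x\<bar> * x powr (norm z - Re s - 1) \<le> \<bar>K\<bar> * x powr (1/2) * x powr (norm z - Re s - 1)"
        by (intro mult_right_mono) auto
      also have "\<dots> = \<bar>K\<bar> * x powr (norm z - Re s - 1/2)" using True by (simp flip: powr_add)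
      finally show ?thesis using True by (simp add: D_def)
    qed (simp add: D_def)
    finally show ?case .
  qed
  have int: "integrable lborel (q j)" for j
  proof (rule Bochner_Integration.integrable_bound[OF D meas_q])
    show "AE x in lborel. norm (q j x) \<le> norm (D x)"
      using sum_le_D[of "Suc j"]
    proof eventually_elim
      case (elim x)
      have "norm (q j x) \<le> (\<Sum>j<Suc j. norm (q j x))" by (simp add: sum_nonneg)
      then show ?case using elim by simp
    qed
  qed
  have "(\<lambda>j. integral\<^sup>L lborel (q j)) sums (\<integral>x. (\<Sum>j. q j x) \<partial>lborel)"
  proof (rule sums_integral[OF int])
    show "AE x in lborel. summable (\<lambda>j. norm (q j x))"
      using norm_sums by (intro AE_I2) (rule sums_summable)
    show "summable (\<lambda>j. \<integral>x. norm (q j x) \<partial>lborel)"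
    proof (rule summableI_nonneg_bounded)
      fix n
      have "(\<Sum>j<n. \<integral>x. norm (q j x) \<partial>lborel) = (\<integral>x. (\<Sum>j<n. norm (q j x)) \<partial>lborel)"
        using int by (intro Bochner_Integration.integral_sum [symmetric]) auto
      also have "\<dots> \<le> integral\<^sup>L lborel D"
        using int D sum_le_D by (intro integral_mono_AE Bochner_Integration.integrable_sum) auto
      finally show "(\<Sum>j<n. \<integral>x. norm (q j x) \<partial>lborel) \<le> integral\<^sup>L lborel D" .
    qed simp
  qed
  also have "(\<integral>x. (\<Sum>j. q j x) \<partial>lborel) =
      (LINT x:{1..}|lborel. of_real (g x) * of_real x powr (- (s + z) - 1))"
    unfolding set_lebesgue_integral_def by (rule Bochner_Integration.integral_cong[OF refl]) (rule sums_unique[OF q_sums, symmetric])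
  also have "(\<lambda>j. integral\<^sup>L lborel (q j)) =
     (\<lambda>j. (-1) ^ j / fact j * (LINT x:{1..}|lborel. of_real (g x * ln x ^ j) * of_real x powr (- s - 1)) * z ^ j)"
  proof
    fix j
    have "q j = (\<lambda>x. (-z) ^ j / fact j * (indicator {1..} x *\<^sub>R (of_real (g x * ln x ^ j) * of_real x powr (- s - 1))))"
      unfolding q_def by (simp only: mult_scaleR_right)
    then have "integral\<^sup>L lborel (q j) = (-z) ^ j / fact j *
         (LINT x:{1..}|lborel. of_real (g x * ln x ^ j) * of_real x powr (- s - 1))"
      unfolding set_lebesgue_integral_def by (simp only: integral_mult_right_zero)
    then show "integral\<^sup>L lborel (q j) = (-1) ^ j / fact j *
         (LINT x:{1..}|lborel. of_real (g x * ln x ^ j) * of_real x powr (- s - 1)) * z ^ j"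
      by (simp add: power_minus[of z])
  qed
  finally show ?thesis .
qed

text \<open>Around each \<open>s\<close> the previous lemma is a power series in the disc reaching
  to the line \<open>Re s = 1/2\<close>, which replaces differentiation under the integral
  sign.\<close>

lemma mellin_tail_holomorphic:
  fixes g :: "real \<Rightarrow> real"
  assumes meas: "set_borel_measurable lborel {1..} g"
    and bd: "AE x in lborel. x \<ge> 1 \<longrightarrow> \<bar>g x\<bar> \<le> K * sqrt x"
  shows "(\<lambda>s. LINT x:{1..}|lborel. of_real (g x) * of_real x powr (- s - 1)) holomorphic_on {s. Re s > 1/2}"
    (is "?I holomorphic_on _")
proof -
  have "?I field_differentiable at s" if s: "Re s > 1/2" for s
  proof -
    have "?I holomorphic_on ball s (Re s - 1/2)"
    proof (rule power_series_holomorphic)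
      fix w assume "w \<in> ball s (Re s - 1/2)"
      then have "norm (w - s) < Re s - 1/2" by (simp add: dist_norm norm_minus_commute)
      from mellin_tail_sums[OF meas bd this]
      show "(\<lambda>j. (-1) ^ j / fact j * (LINT x:{1..}|lborel. of_real (g x * ln x ^ j) * of_real x powr (- s - 1)) * (w - s) ^ j)
          sums ?I w" by simp
    qed
    then show ?thesis using s by (intro holomorphic_on_imp_differentiable_at[of _ "ball s (Re s - 1/2)"]) auto
  qed
  then show ?thesis by (auto simp: holomorphic_on_def field_differentiable_at_within)
qed

text \<open>The ordinates form a countable set, so the limit in the definition of \<^const>\<open>S\<close> never
  needs to be evaluated.\<close>

lemma AE_not_ordinate: "AE x in lborel. \<not> is_ordinate x"
  using AE_not_in[OF countable_imp_null_set_lborel[OF countable_ordinates]] by simp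

lemma F_bound_AE: "\<exists>K. AE x in lborel. x \<ge> 1 \<longrightarrow> \<bar>F x\<bar> \<le> K * sqrt x"
proof -
  obtain K where K: "\<And>T. T \<ge> 1 \<Longrightarrow> \<not> is_ordinate T \<Longrightarrow> \<bar>S_regular T\<bar> \<le> K * sqrt T"
    using S_regular_bound by metis
  have "AE x in lborel. x \<ge> 1 \<longrightarrow> \<bar>F x\<bar> \<le> (K + 2) * sqrt x"
    using AE_not_ordinate
  proof eventually_elim
    case (elim x)
    show ?case
    proof
      assume x: "x \<ge> 1"
      have "\<bar>F x\<bar> \<le> \<bar>S_regular x\<bar> + \<bar>f x\<bar>" using elim by (simp add: F_def S_def)
      moreover have "1 \<le> sqrt x" using x by simp
      ultimately show "\<bar>F x\<bar> \<le> (K + 2) * sqrt x"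
        using K[OF x elim] f_bound[OF x] unfolding distrib_right by linarith
    qed
  qed
  then show ?thesis ..
qed

text \<open>An integrable product could be divided by \<open>p\<close> to recover a measurable
  \<open>g\<close>. The point 1 is restored separately, since \<open>p\<close> may vanish there, as
  powers of \<open>ln x\<close> do.\<close>

lemma set_integral_eq_0_if_not_measurable:
  fixes g :: "real \<Rightarrow> real" and p :: "real \<Rightarrow> complex"
  assumes g: "\<not> set_borel_measurable lborel {1..} g"
    and p: "continuous_on {1<..} p" "\<And>x. x > 1 \<Longrightarrow> p x \<noteq> 0"
  shows "(LINT x:{1..}|lborel. of_real (g x) * p x) = 0"
proof -
  have "\<not> integrable lborel (\<lambda>x. indicator {1..} x *\<^sub>R (of_real (g x) * p x))"
  proof
    assume "integrable lborel (\<lambda>x. indicator {1..} x *\<^sub>R (of_real (g x) * p x))"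
    then have m: "(\<lambda>x. indicator {1..} x *\<^sub>R (of_real (g x) * p x)) \<in> borel_measurable borel"
      using borel_measurable_integrable by force
    have "(\<lambda>x. indicator {1<..} x *\<^sub>R inverse (p x)) \<in> borel_measurable borel"
      using p by (intro borel_measurable_continuous_on_indicator continuous_intros) auto
    note [measurable] = this m
    have "(\<lambda>x. Re ((indicator {1<..} x *\<^sub>R inverse (p x)) * (indicator {1..} x *\<^sub>R (of_real (g x) * p x))))
       \<in> borel_measurable borel"
      by measurable
    moreover have "(\<lambda>x. indicator {1} x *\<^sub>R g x) \<in> borel_measurable borel"
      by (intro borel_measurable_continuous_on_indicator) auto
    ultimately have "(\<lambda>x. Re ((indicator {1<..} x *\<^sub>R inverse (p x)) * (indicator {1..} x *\<^sub>R (of_real (g x) * p x)))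
       + indicator {1} x *\<^sub>R g x) \<in> borel_measurable borel"
      by (intro borel_measurable_add)
    also have "(\<lambda>x. Re ((indicator {1<..} x *\<^sub>R inverse (p x)) * (indicator {1..} x *\<^sub>R (of_real (g x) * p x)))
       + indicator {1} x *\<^sub>R g x) = (\<lambda>x. indicator {1..} x *\<^sub>R g x)"
    proof
      fix x :: real
      consider "x < 1" | "x = 1" | "x > 1" by linarith
      then show "Re ((indicator {1<..} x *\<^sub>R inverse (p x)) * (indicator {1..} x *\<^sub>R (of_real (g x) * p x)))
       + indicator {1} x *\<^sub>R g x = indicator {1..} x *\<^sub>R g x"
        by cases (use p(2)[of x] in \<open>auto simp: field_simps\<close>)
    qed
    finally show False using g by (simp add: set_borel_measurable_def)
  qed
  then show ?thesis unfolding set_lebesgue_integral_def by (rule not_integrable_integral_eq)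
qed

text \<open>The exponent stays \<open>- 1 - 1\<close> to match \<open>mellin_tail_sums\<close> at
  the centre \<open>s = 1\<close>.\<close>

lemma c_eq:
  "complex_of_real (c j) = (-1) ^ j / fact j *
     (LINT x:{1..}|lborel. of_real (F x * ln x ^ j) * of_real x powr (- 1 - 1))"
proof -
  have "(LINT x:{1..}|lborel. of_real (F x * ln x ^ j) * of_real x powr (- 1 - 1)) =
    (LINT x:{1..}|lborel. complex_of_real (F x * ln x ^ j / x ^ 2))"
  proof (rule set_lebesgue_integral_cong)
    have "complex_of_real x powr (- 1 - 1) = of_real (1 / x ^ 2)" if "x \<ge> 1" for x :: real
      using that by (simp add: powr_minus powr_numeral divide_inverse)
    then show "\<forall>x. x \<in> {1..} \<longrightarrow> of_real (F x * ln x ^ j) * of_real x powr (- 1 - 1) = complex_of_real (F x * ln x ^ j / x ^ 2)"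
      by simp
  qed simp
  then show ?thesis unfolding c_def set_integral_complex_of_real by simp
qed

text \<open>If \<^const>\<open>F\<close> failed to be measurable, every Lebesgue integral involved would be 0 by
  convention and the statement would hold trivially; this case distinction replaces a
  proof that \<^const>\<open>S\<close> is measurable.\<close>

lemma F_integral_continuation:
  obtains I where "I holomorphic_on {s. Re s > 1/2}"
    "\<And>s. Re s > 1 \<Longrightarrow> (LINT x:{1..}|lborel. of_real (F x) * of_real x powr (- s - 1)) = I s"
    "\<And>z. norm z < 1/2 \<Longrightarrow> (\<lambda>j. of_real (c j) * z ^ j) sums I (1 + z)"
proof (cases "set_borel_measurable lborel {1..} F")
  case True
  define I where "I = (\<lambda>s. LINT x:{1..}|lborel. of_real (F x) * complex_of_real x powr (- s - 1))"
  obtain K where K: "AE x in lborel. x \<ge> 1 \<longrightarrow> \<bar>F x\<bar> \<le> K * sqrt x" using F_bound_AE ..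
  show ?thesis
  proof
    show "I holomorphic_on {s. Re s > 1/2}"
      unfolding I_def by (rule mellin_tail_holomorphic[OF True K])
    show "(\<lambda>j. of_real (c j) * z ^ j) sums I (1 + z)" if "norm z < 1/2" for z
      unfolding c_eq I_def using that by (intro mellin_tail_sums[OF True K]) simp
  qed (simp add: I_def)
next
  case False
  have "(LINT x:{1..}|lborel. of_real (F x) * complex_of_real x powr (- s - 1)) = 0" for s
    by (rule set_integral_eq_0_if_not_measurable[OF False]) (auto intro!: continuous_intros)
  moreover have "c j = 0" for j
  proof -
    have "(LINT x:{1..}|lborel. of_real (F x) * complex_of_real (ln x ^ j / x ^ 2)) = 0"
      by (rule set_integral_eq_0_if_not_measurable[OF False]) (auto intro!: continuous_intros)
    then have "complex_of_real (LINT x:{1..}|lborel. F x * ln x ^ j / x ^ 2) = 0"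
      by (simp flip: set_integral_complex_of_real)
    then show ?thesis by (simp add: c_def)
  qed
  ultimately show ?thesis by (intro that[of "\<lambda>_. 0"]) auto
qed

subsection \<open>The Laurent expansion\<close>

lemma laurent_expansion_double_pole:
  fixes A B C :: complex and a :: "nat \<Rightarrow> complex"
  assumes J: "J has_fps_expansion Abs_fps a"
  shows "(\<lambda>z. A / z\<^sup>2 - B / z + C + (1 + z) * J z) has_laurent_expansion
     (fls_const A * fls_X_intpow (-2) - fls_const B * fls_X_intpow (-1)
       + fps_to_fls (Abs_fps (\<lambda>j. if j = 0 then C + a 0 else a j + a (j - 1))))"
proof -
  have "(\<lambda>z. C + (1 + z) * J z) has_fps_expansion fps_const C + (1 + fps_X) * Abs_fps a"
    by (intro fps_expansion_intros J)
  also have "fps_const C + (1 + fps_X) * Abs_fps a = Abs_fps (\<lambda>j. if j = 0 then C + a 0 else a j + a (j - 1))"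
    by (rule fps_ext) (simp add: distrib_right)
  finally have "(\<lambda>z. A * z powi (-2) - B * z powi (-1) + (C + (1 + z) * J z)) has_laurent_expansion
     (fls_const A * fls_X_intpow (-2) - fls_const B * fls_X_intpow (-1)
       + fps_to_fls (Abs_fps (\<lambda>j. if j = 0 then C + a 0 else a j + a (j - 1))))"
    by (intro laurent_expansion_intros has_laurent_expansion_fps)
  also have "(\<lambda>z. A * z powi (-2) - B * z powi (-1) + (C + (1 + z) * J z)) =
      (\<lambda>z. A / z\<^sup>2 - B / z + C + (1 + z) * J z)"
    by (simp add: power_int_minus divide_inverse add_ac fun_eq_iff)
  finally show ?thesis .
qed

text \<open>A small punctured disc is connected and meets the half-plane in a nonempty open set, so
  the identity theorem applies. The value at \<open>w\<close> itself stays free, and a Laurent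
  expansion does not see it.\<close>

lemma meromorphic_eventually_eq:
  assumes "g meromorphic_on {w}" "h meromorphic_on {w}" and eq: "\<And>s. Re s > Re w \<Longrightarrow> g s = h s"
  shows "eventually (\<lambda>s. g s = h s) (at w)"
proof -
  obtain r1 r2 where r12: "r1 > 0" "g analytic_on ball w r1 - {w}" "r2 > 0" "h analytic_on ball w r2 - {w}"
    using assms(1,2) unfolding meromorphic_at_iff isolated_singularity_at_def by metis
  define r where "r = min r1 r2"
  have r: "r > 0" using r12 by (simp add: r_def)
  let ?B = "ball w r - {w}"
  let ?V = "ball w r \<inter> {s. Re s > Re w}"
  have an: "g analytic_on ?B" "h analytic_on ?B"
    by (rule analytic_on_subset[OF r12(2)] analytic_on_subset[OF r12(4)], auto simp: r_def)+
  have "g s = h s" if "s \<in> ?B" for s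
  proof (rule analytic_continuation_open[where s = ?V and s' = ?B and f = g and g = h])
    show "open ?V" by (intro open_Int open_ball open_halfspace_Re_gt)
    show "open ?B" by (intro open_delete open_ball)
    have "w + of_real (r / 2) \<in> ?V" using r by (simp add: dist_norm)
    then show "?V \<noteq> {}" by blast
    show "connected ?B" by (intro connected_open_delete) auto
    show "?V \<subseteq> ?B" by auto
    show "g holomorphic_on ?B" "h holomorphic_on ?B" by (intro analytic_imp_holomorphic an)+
  qed (use eq that in auto)
  then show ?thesis using r unfolding eventually_at by (intro exI[of _ r]) (auto simp: dist_commute)
qed

theorem theorem3:
  fixes C1 :: complex
  assumes C1: "\<And>s::complex. Re s > 1 \<Longrightarrow>
    G s = 1 / (2 * pi * (s - 1)^2) - ln (2 * pi) / (2 * pi * (s - 1)) + C1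
          + s * (LINT x:{1..}|lborel. of_real (F x) * of_real x powr (- s - 1))"
  shows "\<exists>b :: nat \<Rightarrow> complex.
    b 0 = C1 + c 0 \<and> (\<forall>j\<ge>1. b j = c j + c (j - 1)) \<and>
    (\<exists>U H. is_continuation_of_G U H) \<and>
    (\<forall>U H. is_continuation_of_G U H \<longrightarrow>
      (\<lambda>z. H (1 + z)) has_laurent_expansion
        (fls_const (1 / (2 * pi)) * fls_X_intpow (-2)
         - fls_const (ln (2 * pi) / (2 * pi)) * fls_X_intpow (-1)
         + fps_to_fls (Abs_fps b)))"
proof -
  obtain I where I: "I holomorphic_on {s. Re s > 1/2}"
    "\<And>s. Re s > 1 \<Longrightarrow> (LINT x:{1..}|lborel. of_real (F x) * of_real x powr (- s - 1)) = I s"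
    "\<And>z. norm z < 1/2 \<Longrightarrow> (\<lambda>j. of_real (c j) * z ^ j) sums I (1 + z)"
    by (rule F_integral_continuation) (rule that)
  \<comment> \<open>Replacing the integral of the hypothesis by \<open>I\<close> extends its
    right-hand side to \<open>Re s > 1/2\<close>; this is the continuation whose existence is
    claimed.\<close>
  define H0 where "H0 = (\<lambda>s. of_real (1 / (2 * pi)) / (s - 1)^2 - of_real (ln (2 * pi) / (2 * pi)) / (s - 1) + C1 + s * I s)"
  define a where "a = (\<lambda>j. complex_of_real (c j))"
  define b where "b = (\<lambda>j::nat. if j = 0 then C1 + a 0 else a j + a (j - 1))"
  have H0_G: "H0 s = G s" if "Re s > 1" for s
    unfolding C1[OF that] I(2)[OF that] H0_def by simp
  have "(\<lambda>z. I (1 + z)) has_fps_expansion Abs_fps a"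
  proof (rule has_fps_expansionI)
    have "eventually (\<lambda>z. z \<in> ball 0 (1/2)) (nhds (0 :: complex))"
      by (intro eventually_nhds_in_open) auto
    then show "eventually (\<lambda>z. (\<lambda>j. fps_nth (Abs_fps a) j * z ^ j) sums I (1 + z)) (nhds 0)"
      by eventually_elim (use I(3) in \<open>simp add: a_def\<close>)
  qed
  from laurent_expansion_double_pole[OF this]
  have H0_laurent: "(\<lambda>z. H0 (1 + z)) has_laurent_expansion
        (fls_const (1 / (2 * pi)) * fls_X_intpow (-2)
         - fls_const (ln (2 * pi) / (2 * pi)) * fls_X_intpow (-1)
         + fps_to_fls (Abs_fps b))"
    unfolding H0_def b_def by (simp only: add_diff_cancel_left')
  let ?U = "{s. Re s > 1/2} :: complex set"
  have "I meromorphic_on ?U"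
    using I(1) unfolding analytic_on_open[OF open_halfspace_Re_gt, symmetric]
    by (rule analytic_on_imp_meromorphic_on)
  then have H0_mero: "H0 meromorphic_on ?U"
    unfolding H0_def by (intro meromorphic_intros)
  have "is_continuation_of_G ?U H0"
    unfolding is_continuation_of_G_def
  proof (intro conjI H0_mero allI impI H0_G)
    show "open ?U" by (rule open_halfspace_Re_gt)
    show "connected ?U" by (intro convex_connected convex_halfspace_Re_gt)
  qed auto
  moreover have "(\<lambda>z. H (1 + z)) has_laurent_expansion
        (fls_const (1 / (2 * pi)) * fls_X_intpow (-2)
         - fls_const (ln (2 * pi) / (2 * pi)) * fls_X_intpow (-1)
         + fps_to_fls (Abs_fps b))" if "is_continuation_of_G U H" for U H
  proof -
    have "eventually (\<lambda>s. H s = H0 s) (at 1)"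
    proof (rule meromorphic_eventually_eq)
      show "H meromorphic_on {1}" "H0 meromorphic_on {1}"
        using that H0_mero unfolding is_continuation_of_G_def by (auto elim: meromorphic_on_subset)
      show "H s = H0 s" if "Re s > Re 1" for s
        using \<open>is_continuation_of_G U H\<close> H0_G[of s] that unfolding is_continuation_of_G_def by simp
    qed
    then show ?thesis
      using H0_laurent by (subst has_laurent_expansion_cong'[OF _ refl refl])
  qed
  ultimately show ?thesis
    by (intro exI[of _ b] conjI) (auto simp: b_def a_def)
qed

end
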